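(* Assume the setting described in the context. For all $r\in(1,2)$, all regular partitionings $\mathcal T^h$ of $\Omega$ and all $\tau_n>0$, there exists a solution $W_{B,r}^n\in S^h$, $Q_{B,r}^n\in V^h$ to the $n$-th step of $(\mathrm Q_{B,r}^{h,\tau})$. In addition, for $\tau\in(0,\frac12]$, solutions satisfy $$\max_{n=0,\dots,N}\|W_{B,r}^n\|_{L^2(\Omega)}+\sum_{n=1}^N\|W_{B,r}^n-W_{B,r}^{n-1}\|_{L^2(\Omega)}^2+\sum_{n=1}^N\tau_n\|Q_{B,r}^n\|_{L^r(\Omega)}^r\le C,\qquad\sum_{n=1}^N\tau_n^2\|\nabla\cdot Q_{B,r}^n\|_{L^2(\Omega)}^2\le C,$$ where $C$ is a positive constant independent of $r$, of the mesh parameter $h$ and of the time step parameter $\tau$.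
   Context: Data. $d\in\{1,2\}$; $\Omega\subset\mathbb R^d$ is a bounded convex polygonal domain (an open interval if $d=1$) with Lipschitz boundary and outward unit normal $\nu$; $T>0$; $k_0>0$ and $\varepsilon>0$ are fixed constants; $f\in L^2(0,T;L^2(\Omega))$ is nonnegative; $w_0^\varepsilon\in W^{1,\infty}_0(\Omega)\cap C^1(\overline\Omega)$ satisfies $\nabla w_0^\varepsilon\cdot\nu<k_0$ on $\partial\Omega$. $(\cdot,\cdot)$ is the $L^2(\Omega)$ inner product. $|a|^{r-2}a:=0$ for $a=0$. Mesh and spaces. $\{\mathcal T^h\}_{h>0}$ is a regular (shape-regular, conforming) family of partitionings of $\Omega$ into disjoint open simplices $\sigma$, $h=\max_{\sigma}\mathrm{diam}(\sigma)$. $S^h$ is the space of functions on $\Omega$ that are constant on each $\sigma$. $U^h$ is the space of continuous functions on $\overline\Omega$ affine on each $\sigma$. $V^h$ is the lowest order Raviart--Thomas space: $v^h\in[L^\infty(\Omega)]^d$ with $v^h|_\sigma=a_\sigma+b_\sigma x$, $a_\sigma\in\mathbb R^d$, $b_\sigma\in\mathbb R$, for every $\sigma$, and with continuous normal component across $\partial\sigma\cap\partial\sigma'$ for all $\sigma,\sigma'\in\mathcal T^h$ (no boundary condition on $\partial\Omega$). $\pi^h:C(\overline\Omega)\to U^h$ is nodal interpolation at the vertices; $P^h:L^1(\Omega)\to S^h$ is the elementwise mean, $P^hv|_\sigma=\frac1{|\sigma|}\int_\sigma v\,dx$. For functions continuous on each closed element, $(\eta,\chi)^h:=\sum_{\sigma\in\mathcal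 T^h}\frac{|\sigma|}{d+1}\sum_{j=1}^{d+1}\eta(x_j^\sigma)\chi(x_j^\sigma)$, with $x_j^\sigma$ the vertices of $\sigma$ and the values taken from within $\sigma$ (products of vectors being dot products). With $w_0^{\varepsilon,h}:=P^h[\pi^hw_0^\varepsilon]$ and $k_{1,\sigma}^{\varepsilon,h}:=\max(k_0,|\nabla\pi^hw_0^\varepsilon|_\sigma|)$, $M_\varepsilon^h:S^h\to S^h$ is defined on each $\sigma$ by: $M_\varepsilon^h(\eta^h)=k_0$ if $\eta^h\ge w_0^{\varepsilon,h}+\varepsilon$; $=k_{1,\sigma}^{\varepsilon,h}+(k_0-k_{1,\sigma}^{\varepsilon,h})\frac{\eta^h-w_0^{\varepsilon,h}}{\varepsilon}$ if $\eta^h\in[w_0^{\varepsilon,h},w_0^{\varepsilon,h}+\varepsilon]$; $=k_{1,\sigma}^{\varepsilon,h}$ if $\eta^h\le w_0^{\varepsilon,h}$. Time discretization. $0=t_0<t_1<\dots<t_N=T$, $\tau_n=t_n-t_{n-1}$, $\tau=\max_n\tau_n$, $f^n:=\frac1{\tau_n}\int_{t_{n-1}}^{t_n}f(\cdot,t)\,dt$. Problem $(\mathrm Q_{B,r}^{h,\tau})$: with $W_{B,r}^0=P^h[\pi^hw_0^\varepsilon]$, for $n=1,\dots,N$ find $W_{B,r}^n\in S^h$ and $Q_{B,r}^n\in V^h$ such that $\left(\frac{W_{B,r}^n-W_{B,r}^{n-1}}{\tau_n},\eta^h\right)+(\nabla\cdot Q_{B,r}^n,\eta^h)=(f^n,\eta^h)$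 for all $\eta^h\in S^h$, and $(M_\varepsilon^h(W_{B,r}^n)|Q_{B,r}^n|^{r-2}Q_{B,r}^n,v^h)^h-(W_{B,r}^n,\nabla\cdot v^h)=0$ for all $v^h\in V^h$. *)

theory Defs
  imports "HOL-Analysis.Analysis"
begin

text \<open>
  All functions are total; those living on a domain or on a mesh matter only there, up to null
  sets. Integrals are therefore taken with respect to the complete measure \<^term>\<open>lebesgue\<close>, so that
  the arbitrary values on the mesh skeleton cannot destroy measurability.
\<close>

section \<open>Differential operators, norms and function spaces\<close>

definition grad :: "('a::euclidean_space \<Rightarrow> real) \<Rightarrow> 'a \<Rightarrow> 'a" where
  "grad u x = (\<Sum>i\<in>Basis. frechet_derivative u (at x) i *\<^sub>R i)"

definition divergence :: "('a::euclidean_space \<Rightarrow> 'a) \<Rightarrow> 'a \<Rightarrow> real" where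
  "divergence v x = (\<Sum>i\<in>Basis. frechet_derivative v (at x) i \<bullet> i)"

text \<open>Value at a boundary point, taken from within the set.\<close>

definition inner_value :: "'a::euclidean_space set \<Rightarrow> ('a \<Rightarrow> 'b::t2_space) \<Rightarrow> 'a \<Rightarrow> 'b" where
  "inner_value S v x = Lim (at x within S) v"

definition L2_inner :: "'a::euclidean_space set \<Rightarrow> ('a \<Rightarrow> real) \<Rightarrow> ('a \<Rightarrow> real) \<Rightarrow> real" where
  "L2_inner \<Omega> u v = (LINT x:\<Omega>|lebesgue. u x * v x)"

definition Lp_norm ::
    "real \<Rightarrow> 'a::euclidean_space set \<Rightarrow> ('a \<Rightarrow> 'b::euclidean_space) \<Rightarrow> real" where
  "Lp_norm p \<Omega> u = (LINT x:\<Omega>|lebesgue. norm (u x) powr p) powr (1 / p)"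

definition Linf_on :: "'a::euclidean_space set \<Rightarrow> ('a \<Rightarrow> 'b::euclidean_space) set" where
  "Linf_on \<Omega> = {u. set_borel_measurable lebesgue \<Omega> u \<and>
                    (\<exists>B. AE x in lebesgue. x \<in> \<Omega> \<longrightarrow> norm (u x) \<le> B)}"

definition C1_compact_support :: "'a::euclidean_space set \<Rightarrow> ('a \<Rightarrow> real) set" where
  "C1_compact_support \<Omega> =
     {\<phi>. \<phi> differentiable_on UNIV \<and> continuous_on UNIV (grad \<phi>) \<and>
         (\<exists>K. compact K \<and> K \<subseteq> \<Omega> \<and> (\<forall>x. x \<notin> K \<longrightarrow> \<phi> x = 0))}"

definition weak_gradient_on ::
    "'a::euclidean_space set \<Rightarrow> ('a \<Rightarrow> real) \<Rightarrow> ('a \<Rightarrow> 'a) \<Rightarrow> bool" where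
  "weak_gradient_on \<Omega> u g \<longleftrightarrow>
     (\<forall>\<phi>\<in>C1_compact_support \<Omega>.
        (LINT x:\<Omega>|lebesgue. u x *\<^sub>R grad \<phi> x) = - (LINT x:\<Omega>|lebesgue. \<phi> x *\<^sub>R g x))"

definition W1inf :: "'a::euclidean_space set \<Rightarrow> ('a \<Rightarrow> real) set" where
  "W1inf \<Omega> = {u \<in> Linf_on \<Omega>. \<exists>g \<in> Linf_on \<Omega>. weak_gradient_on \<Omega> u g}"

text \<open>
  Zero boundary trace. On the domains considered every \<open>W\<^sup>1\<^sup>,\<^sup>\<infinity>\<close> function has a representative
  that is continuous up to the boundary; that representative is meant. (This is not the closure
  of the test functions in the \<open>W\<^sup>1\<^sup>,\<^sup>\<infinity>\<close> norm, which would force the gradient to vanish on the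
  boundary as well.)
\<close>

definition W1inf0 :: "'a::euclidean_space set \<Rightarrow> ('a \<Rightarrow> real) set" where
  "W1inf0 \<Omega> = {u \<in> W1inf \<Omega>. continuous_on (closure \<Omega>) u \<and> (\<forall>x\<in>frontier \<Omega>. u x = 0)}"

definition C1_closure :: "'a::euclidean_space set \<Rightarrow> ('a \<Rightarrow> real) set" where
  "C1_closure \<Omega> =
     {u. continuous_on (closure \<Omega>) u \<and> u differentiable_on \<Omega> \<and>
         (\<exists>G. continuous_on (closure \<Omega>) G \<and> (\<forall>x\<in>\<Omega>. G x = grad u x))}"

text \<open>
  \<open>L\<^sup>2(0,T;L\<^sup>2(\<Omega>))\<close>, identified as usual with \<open>L\<^sup>2((0,T)\<times>\<Omega>)\<close>, i.e. given by a jointly measurable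
  representative.
\<close>

definition L2_L2 :: "real \<Rightarrow> 'a::euclidean_space set \<Rightarrow> (real \<Rightarrow> 'a \<Rightarrow> real) set" where
  "L2_L2 T \<Omega> =
     {f. (\<lambda>(t, x). f t x) \<in> borel_measurable (lebesgue_on {0<..<T} \<Otimes>\<^sub>M lebesgue_on \<Omega>) \<and>
         integrable (lebesgue_on {0<..<T} \<Otimes>\<^sub>M lebesgue_on \<Omega>) (\<lambda>(t, x). (f t x)\<^sup>2)}"

section \<open>The domain\<close>

text \<open>
  In dimension 1 this is a bounded open interval. A bounded convex open set automatically has a
  Lipschitz boundary.
\<close>

definition convex_polygonal_domain :: "'a::euclidean_space set \<Rightarrow> bool" where
  "convex_polygonal_domain \<Omega> \<longleftrightarrow>
     \<Omega> \<noteq> {} \<and> open \<Omega> \<and> bounded \<Omega> \<and> convex \<Omega> \<and> polytope (closure \<Omega>)"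

text \<open>
  For convex \<open>\<Omega>\<close>: the unit vectors of the normal cone at \<open>x\<close> reduce to \<open>\<nu>\<close>. At corners of a polygon
  no vector qualifies, matching the fact that the outward normal is undefined there.
\<close>

definition outward_unit_normal :: "'a::euclidean_space set \<Rightarrow> 'a \<Rightarrow> 'a \<Rightarrow> bool" where
  "outward_unit_normal \<Omega> x \<nu> \<longleftrightarrow>
     x \<in> frontier \<Omega> \<and> {u. norm u = 1 \<and> (\<forall>y\<in>\<Omega>. (y - x) \<bullet> u \<le> 0)} = {\<nu>}"

section \<open>Meshes and discrete spaces\<close>

text \<open>
  A mesh is a set of open simplices. \<^const>\<open>triangulation\<close> states finiteness and conformity: any two
  closed simplices meet in a common (possibly empty) face.
\<close>

definition conforming_partition :: "'a::euclidean_space set \<Rightarrow> 'a set set \<Rightarrow> bool" where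
  "conforming_partition \<Omega> \<T> \<longleftrightarrow>
     (\<forall>\<sigma>\<in>\<T>. int DIM('a) simplex (closure \<sigma>) \<and> \<sigma> = interior (closure \<sigma>)) \<and>
     disjoint \<T> \<and> triangulation (closure ` \<T>) \<and>
     closure \<Omega> = (\<Union>\<sigma>\<in>\<T>. closure \<sigma>)"

definition regular_family :: "'a::euclidean_space set \<Rightarrow> 'a set set set \<Rightarrow> bool" where
  "regular_family \<Omega> \<F> \<longleftrightarrow>
     (\<forall>\<T>\<in>\<F>. conforming_partition \<Omega> \<T>) \<and>
     (\<exists>\<kappa>>0. \<forall>\<T>\<in>\<F>. \<forall>\<sigma>\<in>\<T>. \<exists>c \<rho>. ball c \<rho> \<subseteq> \<sigma> \<and> diameter \<sigma> \<le> \<kappa> * \<rho>)"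

definition vertices :: "'a::euclidean_space set \<Rightarrow> 'a set" where
  "vertices \<sigma> = {x. x extreme_point_of closure \<sigma>}"

definition S_space :: "'a::euclidean_space set set \<Rightarrow> ('a \<Rightarrow> real) set" where
  "S_space \<T> = {\<eta>. \<forall>\<sigma>\<in>\<T>. \<eta> constant_on \<sigma>}"

definition U_space ::
    "'a::euclidean_space set \<Rightarrow> 'a set set \<Rightarrow> ('a \<Rightarrow> real) set" where
  "U_space \<Omega> \<T> =
     {u. continuous_on (closure \<Omega>) u \<and> (\<forall>\<sigma>\<in>\<T>. \<exists>a b. \<forall>x\<in>\<sigma>. u x = a + b \<bullet> x)}"

text \<open>
  Lowest order Raviart--Thomas space. Membership in \<open>L\<^sup>\<infinity>\<close> is automatic. The normal component is
  required to match on common facets, i.e. where \<open>\<partial>\<sigma> \<inter> \<partial>\<sigma>'\<close> has codimension 1 (lower-dimensional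
  intersections carry no normal); it makes the elementwise \<^const>\<open>divergence\<close> the weak one.
\<close>

definition V_space :: "'a::euclidean_space set set \<Rightarrow> ('a \<Rightarrow> 'a) set" where
  "V_space \<T> =
     {v. (\<forall>\<sigma>\<in>\<T>. \<exists>a b. \<forall>x\<in>\<sigma>. v x = a + b *\<^sub>R x) \<and>
         (\<forall>\<sigma>\<in>\<T>. \<forall>\<sigma>'\<in>\<T>. \<forall>n.
            aff_dim (frontier \<sigma> \<inter> frontier \<sigma>') = int DIM('a) - 1 \<and>
            (\<forall>x\<in>frontier \<sigma> \<inter> frontier \<sigma>'. \<forall>y\<in>frontier \<sigma> \<inter> frontier \<sigma>'. n \<bullet> (x - y) = 0) \<longrightarrow>
            (\<forall>x\<in>frontier \<sigma> \<inter> frontier \<sigma>'. inner_value \<sigma> v x \<bullet> n = inner_value \<sigma>' v x \<bullet> n))}"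

text \<open>The interpolant is unique on \<open>closure \<Omega>\<close>; its values elsewhere are irrelevant.\<close>

definition nodal_interp ::
    "'a::euclidean_space set \<Rightarrow> 'a set set \<Rightarrow> ('a \<Rightarrow> real) \<Rightarrow> 'a \<Rightarrow> real" where
  "nodal_interp \<Omega> \<T> w =
     (SOME u. u \<in> U_space \<Omega> \<T> \<and> (\<forall>\<sigma>\<in>\<T>. \<forall>x\<in>vertices \<sigma>. u x = w x))"

definition elem_mean :: "'a::euclidean_space set set \<Rightarrow> ('a \<Rightarrow> real) \<Rightarrow> 'a \<Rightarrow> real" where
  "elem_mean \<T> v x =
     (\<Sum>\<sigma>\<in>\<T>. indicat_real \<sigma> x * ((LINT y:\<sigma>|lebesgue. v y) / measure lebesgue \<sigma>))"

definition quad_inner ::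
    "'a::euclidean_space set set \<Rightarrow> ('a \<Rightarrow> 'b::real_inner) \<Rightarrow> ('a \<Rightarrow> 'b) \<Rightarrow> real" where
  "quad_inner \<T> \<eta> \<xi> =
     (\<Sum>\<sigma>\<in>\<T>. measure lebesgue \<sigma> / (real DIM('a) + 1) *
        (\<Sum>x\<in>vertices \<sigma>. inner_value \<sigma> \<eta> x \<bullet> inner_value \<sigma> \<xi> x))"

definition w0h ::
    "'a::euclidean_space set \<Rightarrow> 'a set set \<Rightarrow> ('a \<Rightarrow> real) \<Rightarrow> 'a \<Rightarrow> real" where
  "w0h \<Omega> \<T> w0 = elem_mean \<T> (nodal_interp \<Omega> \<T> w0)"

definition k1h ::
    "'a::euclidean_space set \<Rightarrow> 'a set set \<Rightarrow> real \<Rightarrow> ('a \<Rightarrow> real) \<Rightarrow> 'a \<Rightarrow> real" where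
  "k1h \<Omega> \<T> k0 w0 x = max k0 (norm (grad (nodal_interp \<Omega> \<T> w0) x))"

definition M_op ::
    "'a::euclidean_space set \<Rightarrow> 'a set set \<Rightarrow> real \<Rightarrow> real \<Rightarrow> ('a \<Rightarrow> real)
      \<Rightarrow> ('a \<Rightarrow> real) \<Rightarrow> 'a \<Rightarrow> real" where
  "M_op \<Omega> \<T> k0 \<epsilon> w0 \<eta> x =
     (if \<eta> x \<ge> w0h \<Omega> \<T> w0 x + \<epsilon> then k0
      else if \<eta> x \<ge> w0h \<Omega> \<T> w0 x
        then k1h \<Omega> \<T> k0 w0 x + (k0 - k1h \<Omega> \<T> k0 w0 x) * ((\<eta> x - w0h \<Omega> \<T> w0 x) / \<epsilon>)
      else k1h \<Omega> \<T> k0 w0 x)"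

section \<open>Time discretization and the discrete problem\<close>

definition time_partition :: "real \<Rightarrow> nat \<Rightarrow> (nat \<Rightarrow> real) \<Rightarrow> bool" where
  "time_partition T N t \<longleftrightarrow> t 0 = 0 \<and> t N = T \<and> (\<forall>n\<in>{1..N}. t (n - 1) < t n)"

definition tstep :: "(nat \<Rightarrow> real) \<Rightarrow> nat \<Rightarrow> real" where
  "tstep t n = t n - t (n - 1)"

definition time_mean ::
    "(nat \<Rightarrow> real) \<Rightarrow> (real \<Rightarrow> 'a::euclidean_space \<Rightarrow> real) \<Rightarrow> nat \<Rightarrow> 'a \<Rightarrow> real" where
  "time_mean t f n x = (LINT s:{t (n - 1)<..<t n}|lebesgue. f s x) / tstep t n"

text \<open>
  The \<open>n\<close>-th step, with \<open>Wp\<close> the solution at the previous time level. The convention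
  \<open>|a|\<^bsup>r-2\<^esup>a = 0\<close> for \<open>a = 0\<close> holds because the factor \<open>a\<close> vanishes.
\<close>

definition Q_step ::
    "'a::euclidean_space set \<Rightarrow> 'a set set \<Rightarrow> real \<Rightarrow> real \<Rightarrow> ('a \<Rightarrow> real) \<Rightarrow> (real \<Rightarrow> 'a \<Rightarrow> real)
      \<Rightarrow> (nat \<Rightarrow> real) \<Rightarrow> real \<Rightarrow> nat \<Rightarrow> ('a \<Rightarrow> real) \<Rightarrow> ('a \<Rightarrow> real) \<Rightarrow> ('a \<Rightarrow> 'a) \<Rightarrow> bool" where
  "Q_step \<Omega> \<T> k0 \<epsilon> w0 f t r n Wp W Q \<longleftrightarrow>
     W \<in> S_space \<T> \<and> Q \<in> V_space \<T> \<and>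
     (\<forall>\<eta>\<in>S_space \<T>.
        L2_inner \<Omega> (\<lambda>x. (W x - Wp x) / tstep t n) \<eta> + L2_inner \<Omega> (divergence Q) \<eta>
          = L2_inner \<Omega> (time_mean t f n) \<eta>) \<and>
     (\<forall>v\<in>V_space \<T>.
        quad_inner \<T> (\<lambda>x. M_op \<Omega> \<T> k0 \<epsilon> w0 W x *\<^sub>R (norm (Q x) powr (r - 2) *\<^sub>R Q x)) v
          - L2_inner \<Omega> W (divergence v) = 0)"

text \<open>\<open>W\<close>, \<open>Q\<close> solve the initial condition and the steps \<open>1, \<dots>, m\<close>.\<close>

definition Q_solution ::
    "'a::euclidean_space set \<Rightarrow> 'a set set \<Rightarrow> real \<Rightarrow> real \<Rightarrow> ('a \<Rightarrow> real) \<Rightarrow> (real \<Rightarrow> 'a \<Rightarrow> real)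
      \<Rightarrow> (nat \<Rightarrow> real) \<Rightarrow> real \<Rightarrow> nat \<Rightarrow> (nat \<Rightarrow> 'a \<Rightarrow> real) \<Rightarrow> (nat \<Rightarrow> 'a \<Rightarrow> 'a) \<Rightarrow> bool" where
  "Q_solution \<Omega> \<T> k0 \<epsilon> w0 f t r m W Q \<longleftrightarrow>
     W 0 = elem_mean \<T> (nodal_interp \<Omega> \<T> w0) \<and>
     (\<forall>n\<in>{1..m}. Q_step \<Omega> \<T> k0 \<epsilon> w0 f t r n (W (n - 1)) (W n) (Q n))"

end

theory Submission
  imports Defs "HOL-Homology.Homology" "HOL-Library.Function_Algebras"
begin

text \<open>
  Existence: on the finite-dimensional space of pairs \<open>(W, Q)\<close>, the two equations of a time step
  (scaled by the step size and tested with \<open>(\<eta>, v)\<close>) form a continuous vector field. Tested with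
  \<open>(W, Q)\<close> itself the two coupling terms cancel, and what remains is bounded below by
  \<open>\<parallel>W\<parallel>\<^sup>2 + \<tau> k\<^sub>0 (|Q|\<^sup>r, 1)\<^sup>h\<close> minus a linear term, which is positive on a large sphere because
  \<open>r > 1\<close>. Brouwer degree gives a zero.

  Estimates: testing with \<open>\<eta> = W\<^sup>n\<close>, \<open>v = Q\<^sup>n\<close> and a discrete Gronwall argument (this uses
  \<open>\<tau> \<le> 1/2\<close>) bound everything but the divergence, for which one tests with \<open>\<eta> = \<nabla> \<cdot> Q\<^sup>n\<close>.
  The constant depends only on \<open>k\<^sub>0\<close>, \<open>T\<close>, the dimension, \<open>|\<Omega>|\<close>, the norm of \<open>f\<close> and the maximum of
  \<open>|w\<^sub>0|\<close>.
\<close>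

section \<open>Zeros of coercive vector fields\<close>

text \<open>The functions in \<open>S_space\<close> and \<open>V_space\<close> are total and
  arbitrary off the elements, so they form no finite-dimensional space. The unknown is therefore a
  family of coefficient triples, one per element, linked to functions by \<open>represents\<close>;
  continuity of normal components becomes linear in the coefficients. The energy scales unevenly:
  quadratically in W, with power r in Q. Since r < 2, stretching a state on the unit sphere by R
  \<ge> 1 leaves at least R^r times a fixed positive continuous function, minus R times a data term;
  compactness of the sphere then gives one radius for all directions. The coefficient depends on W
  and the mesh but enters the lower bounds only through k0. Uniformity in r and h comes from keeping
  the r-th power of Q as a power and comparing it with the quadrature on each element, where the
  number of vertices is the only loss. The divergence is piecewise constant, hence an admissible
  test function; the weight of the squared step size turns the difference quotient of W into the
  differences already bounded.\<close>

lemma continuous_map_normalize_nsphere: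
  assumes K: "\<And>i. i \<le> n \<Longrightarrow> continuous_map X euclideanreal (\<lambda>x. K x i)"
    and nz: "\<And>x. x \<in> topspace X \<Longrightarrow> (\<Sum>i\<le>n. (K x i)\<^sup>2) \<noteq> 0"
  shows "continuous_map X (nsphere n)
           (\<lambda>x i. if i < Suc n then K x i / sqrt (\<Sum>j\<le>n. (K x j)\<^sup>2) else 0)"
proof -
  have "(\<Sum>i\<le>n. (if i < Suc n then K x i / sqrt (\<Sum>j\<le>n. (K x j)\<^sup>2) else 0)\<^sup>2) = 1"
    if "x \<in> topspace X" for x
  proof -
    have "(\<Sum>i\<le>n. (if i < Suc n then K x i / sqrt (\<Sum>j\<le>n. (K x j)\<^sup>2) else 0)\<^sup>2)
        = (\<Sum>i\<le>n. (K x i)\<^sup>2 / (\<Sum>j\<le>n. (K x j)\<^sup>2))"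
      by (intro sum.cong) (auto simp: power_divide sum_nonneg)
    also have "\<dots> = 1"
      using nz[OF that] by (simp flip: sum_divide_distrib)
    finally show ?thesis .
  qed
  moreover have "continuous_map X euclideanreal (\<lambda>x. K x i / sqrt (\<Sum>j\<le>n. (K x j)\<^sup>2))"
    if "i < Suc n" for i
    using that nz by (intro continuous_map_real_divide continuous_map_sqrt continuous_intros K) auto
  ultimately show ?thesis
    unfolding nsphere_def continuous_map_in_subtopology continuous_map_componentwise_Euclidean_space
    by auto
qed

text \<open>
  Without a zero, the normalised field would be nullhomotopic on the sphere of radius \<open>R\<close> (shrink
  the radius), but positivity of the inner product with \<open>x\<close> makes it homotopic to the identity.
  The dimension depends on the mesh, so the index-type spaces \<open>real ^ 'n\<close> cannot be used.
\<close>

lemma coercive_field_has_zero: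
  fixes F :: "(nat \<Rightarrow> real) \<Rightarrow> nat \<Rightarrow> real"
  assumes R: "R > 0"
    and cont: "\<And>i. i < m \<Longrightarrow> continuous_on {x. \<forall>j\<ge>m. x j = 0} (\<lambda>x. F x i)"
    and pos: "\<And>x. \<forall>j\<ge>m. x j = 0 \<Longrightarrow> (\<Sum>i<m. (x i)\<^sup>2) = R\<^sup>2 \<Longrightarrow> (\<Sum>i<m. F x i * x i) > 0"
  shows "\<exists>x. (\<forall>j\<ge>m. x j = 0) \<and> (\<forall>i<m. F x i = 0)"
proof (cases m)
  case 0
  then show ?thesis by auto
next
  case (Suc n)
  let ?nz = "\<lambda>K i. if i < Suc n then K i / sqrt (\<Sum>j\<le>n. (K j)\<^sup>2) else (0::real)"
  show ?thesis
  proof (rule ccontr)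
    assume no: "\<not> ?thesis"
    have Fnz: "(\<Sum>i\<le>n. (F x i)\<^sup>2) \<noteq> 0" if "\<forall>j\<ge>m. x j = 0" for x
      using no that by (auto simp: sum_nonneg_eq_0_iff Suc less_Suc_eq_le)
    let ?P = "prod_topology (top_of_set {0..1::real}) (nsphere n)"
    have top: "\<forall>i\<ge>m. x i = 0" "(\<Sum>i\<le>n. (x i)\<^sup>2) = 1" if "x \<in> topspace (nsphere n)" for x
      using that by (auto simp: nsphere_def topspace_Euclidean_space Suc)
    have fstc: "continuous_map ?P euclideanreal (\<lambda>p. fst p)"
      using continuous_map_fst continuous_map_into_fulltopology by blast
    have sndc: "continuous_map ?P euclideanreal (\<lambda>p. snd p i)" for i
      using continuous_map_compose[OF continuous_map_snd continuous_map_nsphere_projection]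
      by (simp add: o_def)
    \<comment> \<open>The factor \<open>a\<close> is left free to serve both homotopies:
      \<open>fst\<close> shrinks the radius, the constant 1 belongs to the segment, which is why
      \<open>R * 1\<close> appears below.\<close>
    have Fc: "continuous_map ?P euclideanreal (\<lambda>p. F (\<lambda>j. R * a p * snd p j) i)"
      if a: "continuous_map ?P euclideanreal a" and i: "i < m" for a i
    proof -
      have 1: "continuous_map ?P (Euclidean_space m)
              (\<lambda>p j. if j < m then R * a p * snd p j else 0)"
        unfolding continuous_map_componentwise_Euclidean_space
        by (intro allI impI continuous_intros a sndc)
      have 2: "continuous_map (Euclidean_space m) euclideanreal (\<lambda>x. F x i)"
        using cont[OF i] by (simp add: continuous_map_Euclidean_space_iff topspace_Euclidean_space)
      have "(\<lambda>j. if j < m then R * a p * snd p j else 0) = (\<lambda>j. R * a p * snd p j)"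
        if "p \<in> topspace ?P" for p
        using top(1)[of "snd p"] that by (auto simp: fun_eq_iff)
      then show ?thesis
        using continuous_map_compose[OF 1 2] by (auto elim!: continuous_map_eq)
    qed
    have 1: "homotopic_with (\<lambda>_. True) (nsphere n) (nsphere n)
            (\<lambda>x. ?nz (F (\<lambda>j. R * x j))) (\<lambda>x. ?nz (F (\<lambda>j. 0)))"
    proof (rule homotopic_with_sym[THEN iffD1], unfold homotopic_with_def, intro exI conjI allI impI ballI)
      let ?h = "\<lambda>p. ?nz (F (\<lambda>j. R * fst p * snd p j))"
      show "continuous_map ?P (nsphere n) ?h"
        by (rule continuous_map_normalize_nsphere) (use top(1) Suc in \<open>auto intro!: Fc fstc Fnz\<close>)
    qed auto
    have 2: "homotopic_with (\<lambda>_. True) (nsphere n) (nsphere n)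
            id (\<lambda>x. ?nz (F (\<lambda>j. R * x j)))"
    proof (subst homotopic_with, simp, intro exI conjI allI impI ballI)
      \<comment> \<open>The segment from x to F(R x), normalised. Its inner product with x is (1 -
        t) plus t times a positive number, so it avoids zero.\<close>
      let ?h = "\<lambda>p. ?nz (\<lambda>i. (1 - fst p) * snd p i + fst p * F (\<lambda>j. R * 1 * snd p j) i)"
      show "continuous_map ?P (nsphere n) ?h"
      proof (rule continuous_map_normalize_nsphere)
        show "continuous_map ?P euclideanreal (\<lambda>p. (1 - fst p) * snd p i + fst p * F (\<lambda>j. R * 1 * snd p j) i)"
          if "i \<le> n" for i
          using that Suc by (intro continuous_intros fstc sndc Fc) auto
        fix p assume p: "p \<in> topspace ?P"
        let ?t = "fst p" and ?x = "snd p"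
        have t: "0 \<le> ?t" "?t \<le> 1" and x: "?x \<in> topspace (nsphere n)"
          using p by auto
        have "(\<Sum>i<m. (R * ?x i)\<^sup>2) = R\<^sup>2"
          using top(2)[OF x] by (simp add: power_mult_distrib Suc lessThan_Suc_atMost flip: sum_distrib_left)
        then have "(\<Sum>i<m. F (\<lambda>j. R * ?x j) i * (R * ?x i)) > 0"
          using top(1)[OF x] by (intro pos) auto
        also have "(\<Sum>i<m. F (\<lambda>j. R * ?x j) i * (R * ?x i)) = R * (\<Sum>i\<le>n. F (\<lambda>j. R * ?x j) i * ?x i)"
          by (simp add: sum_distrib_left Suc lessThan_Suc_atMost ac_simps)
        finally have Fx: "(\<Sum>i\<le>n. F (\<lambda>j. R * ?x j) i * ?x i) > 0"
          using R by (simp add: zero_less_mult_iff)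
        have "(\<Sum>i\<le>n. ((1 - ?t) * ?x i + ?t * F (\<lambda>j. R * 1 * ?x j) i) * ?x i)
           = (1 - ?t) * (\<Sum>i\<le>n. (?x i)\<^sup>2) + ?t * (\<Sum>i\<le>n. F (\<lambda>j. R * ?x j) i * ?x i)"
          by (simp add: sum_distrib_left sum.distrib[symmetric] power2_eq_square algebra_simps)
        also have "\<dots> = (1 - ?t) + ?t * (\<Sum>i\<le>n. F (\<lambda>j. R * ?x j) i * ?x i)"
          using top(2)[OF x] by simp
        also have "\<dots> > 0"
          using t Fx by (cases "?t = 0") (auto intro: add_nonneg_pos)
        finally have pos': "(\<Sum>i\<le>n. ((1 - ?t) * ?x i + ?t * F (\<lambda>j. R * 1 * ?x j) i) * ?x i) > 0" .
        show "(\<Sum>i\<le>n. ((1 - ?t) * ?x i + ?t * F (\<lambda>j. R * 1 * ?x j) i)\<^sup>2) \<noteq> 0"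
        proof
          assume "(\<Sum>i\<le>n. ((1 - ?t) * ?x i + ?t * F (\<lambda>j. R * 1 * ?x j) i)\<^sup>2) = 0"
          then have "\<forall>i\<in>{..n}. (1 - ?t) * ?x i + ?t * F (\<lambda>j. R * 1 * ?x j) i = 0"
            by (simp add: sum_nonneg_eq_0_iff)
          then show False
            using pos' by simp
        qed
      qed
      show "?h (0, x) = id x" if "x \<in> topspace (nsphere n)" for x
        using top[OF that] Suc by (auto simp: fun_eq_iff not_less)
    qed auto
    have "Brouwer_degree2 n id = 0"
      using homotopic_with_trans[OF 2 1] Brouwer_degree2_nullhomotopic by blast
    then show False by simp
  qed
qed

text \<open>Tychonoff: in the product topology on sequences the sphere is a closed part of a product
  of intervals, degenerate from coordinate \<open>m\<close> on.\<close>

lemma compact_sphere_Euclidean: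
  "compact {x::nat \<Rightarrow> real. (\<forall>j\<ge>m. x j = 0) \<and> (\<Sum>i<m. (x i)\<^sup>2) = 1}" (is "compact ?S")
proof -
  let ?C = "\<lambda>i. if i < m then {-1..1} else {0::real}"
  have "compactin (powertop_real UNIV) (PiE UNIV ?C)"
    by (auto simp: compactin_PiE)
  then have "compact (PiE UNIV ?C)"
    by (simp add: euclidean_product_topology)
  moreover have "closed ({x. \<forall>j\<ge>m. x j = 0} \<inter> {x::nat \<Rightarrow> real. (\<Sum>i<m. (x i)\<^sup>2) = 1})"
    by (intro closed_Int closed_Collect_all closed_Collect_imp closed_Collect_eq open_Collect_const
        continuous_intros continuous_on_product_coordinates)
  ultimately have "compact (PiE UNIV ?C \<inter> ({x. \<forall>j\<ge>m. x j = 0} \<inter> {x. (\<Sum>i<m. (x i)\<^sup>2) = 1}))"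
    by (rule compact_Int_closed)
  also have "PiE UNIV ?C \<inter> ({x. \<forall>j\<ge>m. x j = 0} \<inter> {x. (\<Sum>i<m. (x i)\<^sup>2) = 1}) = ?S"
  proof -
    have "\<bar>x i\<bar> \<le> 1" if "(\<Sum>i<m. (x i)\<^sup>2) = 1" "i < m" for x :: "nat \<Rightarrow> real" and i
      using member_le_sum[of i "{..<m}" "\<lambda>i. (x i)\<^sup>2"] that by (simp add: abs_square_le_1)
    then show ?thesis
      by (auto simp: PiE_UNIV_domain abs_le_iff)
  qed
  finally show ?thesis .
qed

text \<open>On the unit sphere \<open>G \<ge> c > 0\<close> and \<open>H \<le> C\<close> by
  compactness, so at radius R the pairing of the field with its argument is at least
  \<open>R * (R powr (r - 1) * c - C)\<close>. Coercivity thus has to be checked only along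
  rays.\<close>

lemma homogeneously_coercive_field_has_zero:
  fixes F :: "(nat \<Rightarrow> real) \<Rightarrow> nat \<Rightarrow> real" and m :: nat
  defines "E \<equiv> {x. \<forall>j\<ge>m. x j = 0}"
  assumes cont: "\<And>i. i < m \<Longrightarrow> continuous_on E (\<lambda>x. F x i)"
    and G: "continuous_on E G" and H: "continuous_on E H"
    and r: "r > 1"
    and Gpos: "\<And>x. x \<in> E \<Longrightarrow> (\<Sum>i<m. (x i)\<^sup>2) = 1 \<Longrightarrow> G x > (0::real)"
    and coercive: "\<And>R x. R \<ge> 1 \<Longrightarrow> x \<in> E \<Longrightarrow>
            (\<Sum>i<m. F (\<lambda>j. R * x j) i * (R * x i)) \<ge> R powr r * G x - R * H x"
  shows "\<exists>x\<in>E. \<forall>i<m. F x i = 0"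
proof -
  let ?S = "{x::nat \<Rightarrow> real. (\<forall>j\<ge>m. x j = 0) \<and> (\<Sum>i<m. (x i)\<^sup>2) = 1}"
  have SE: "?S \<subseteq> E" by (auto simp: E_def)
  obtain c where c: "c > 0" "\<And>x. x \<in> ?S \<Longrightarrow> G x \<ge> c"
  proof (cases "?S = {}")
    case False
    then obtain x where "x \<in> ?S" "\<forall>y\<in>?S. G x \<le> G y"
      using continuous_attains_inf[OF compact_sphere_Euclidean _ continuous_on_subset[OF G SE]] by blast
    then show ?thesis using Gpos[of x] SE that[of "G x"] by auto
  next
    \<comment> \<open>The sphere is empty only for \<open>m = 0\<close>; any positive
      \<open>c\<close> will do.\<close>
    case True
    have "1 \<le> G x" if "x \<in> ?S" for x
      using that unfolding True by blast
    then show ?thesis by (rule that[OF zero_less_one])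
  qed
  have "bounded (H ` ?S)"
    by (intro compact_imp_bounded compact_continuous_image continuous_on_subset[OF H SE] compact_sphere_Euclidean)
  then obtain C' where C': "\<And>x. x \<in> ?S \<Longrightarrow> \<bar>H x\<bar> \<le> C'"
    unfolding bounded_iff real_norm_def by blast
  define C where "C = \<bar>C'\<bar>"
  have C: "H x \<le> C" if "x \<in> ?S" for x
    using C'[OF that] by (simp add: C_def)
  \<comment> \<open>Chosen so that \<open>R powr (r - 1) * c = C + c\<close>, which exceeds
    \<open>C\<close>. Taking \<open>C\<close> as an absolute value makes the base at least 1, hence
    also \<open>R \<ge> 1\<close>, where the coercivity hypothesis applies.\<close>
  define R where "R = (C / c + 1) powr (1 / (r - 1))"
  have Cc: "C / c \<ge> 0" using c by (simp add: C_def)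
  have R1: "R \<ge> 1"
    unfolding R_def using Cc r by (intro ge_one_powr_ge_zero) auto
  have "R powr (r - 1) = C / c + 1"
    using Cc r by (simp add: R_def powr_powr)
  then have Rr: "R powr (r - 1) * c > C"
    using c by (simp add: field_simps)
  have "\<exists>x. (\<forall>j\<ge>m. x j = 0) \<and> (\<forall>i<m. F x i = 0)"
  proof (rule coercive_field_has_zero)
    show "R > 0" using R1 by simp
    show "continuous_on {x. \<forall>j\<ge>m. x j = 0} (\<lambda>x. F x i)" if "i < m" for i
      using cont[OF that] by (simp add: E_def)
    fix x :: "nat \<Rightarrow> real" assume x: "\<forall>j\<ge>m. x j = 0" "(\<Sum>i<m. (x i)\<^sup>2) = R\<^sup>2"
    define y where "y = (\<lambda>i. x i / R)"
    have xy: "x = (\<lambda>i. R * y i)" using R1 by (auto simp: y_def)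
    have y: "y \<in> ?S"
      using x R1 by (auto simp: y_def power_divide simp flip: sum_divide_distrib)
    have "0 < R * (R powr (r - 1) * c - C)"
      using Rr R1 by simp
    also have "\<dots> = R powr r * c - R * C"
      using R1 powr_add[of R 1 "r - 1"] by (simp add: algebra_simps)
    also have "\<dots> \<le> R powr r * G y - R * H y"
      using c(2)[OF y] C[OF y] R1 by (intro diff_mono mult_left_mono) auto
    also have "\<dots> \<le> (\<Sum>i<m. F x i * x i)"
      using coercive[OF R1, of y] y SE by (auto simp: xy)
    finally show "(\<Sum>i<m. F x i * x i) > 0" .
  qed
  then show ?thesis by (auto simp: E_def)
qed

text \<open>The maps with a single value from \<open>Basis\<close> at one point of \<open>K\<close>
  span everything supported on \<open>K\<close>, so an independent subset of \<open>X\<close> is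
  finite. The basis is enumerated by naturals because the field whose zero is sought acts on
  sequences. The vector space is a local interpretation with pointwise scaling.\<close>

lemma finite_basis_of_finitely_supported:
  fixes X :: "('k \<Rightarrow> 'c::euclidean_space) set"
  assumes K: "finite K"
    and supp: "\<And>g k. g \<in> X \<Longrightarrow> k \<notin> K \<Longrightarrow> g k = 0"
    and zero: "(\<lambda>k. 0) \<in> X"
    and add: "\<And>g h. g \<in> X \<Longrightarrow> h \<in> X \<Longrightarrow> (\<lambda>k. g k + h k) \<in> X"
    and scale: "\<And>c g. g \<in> X \<Longrightarrow> (\<lambda>k. c *\<^sub>R g k) \<in> X"
  shows "\<exists>(m::nat) e. (\<forall>x. (\<lambda>k. \<Sum>i<m. x i *\<^sub>R e i k) \<in> X) \<and>
    (\<forall>g\<in>X. \<exists>x. g = (\<lambda>k. \<Sum>i<m. x i *\<^sub>R e i k)) \<and>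
    (\<forall>x. (\<forall>k. (\<Sum>i<m. x i *\<^sub>R e i k) = 0) \<longrightarrow> (\<forall>i<m. x i = 0))"
proof -
  let ?s = "\<lambda>c g (k::'k). c *\<^sub>R (g k :: 'c)"
  interpret V: vector_space ?s
    by standard (auto simp: fun_eq_iff algebra_simps)
  have sum_apply: "(\<Sum>v\<in>B. f v) k = (\<Sum>v\<in>B. f v k)" for B :: "'b set" and f :: "'b \<Rightarrow> 'k \<Rightarrow> 'c" and k
    by (induction B rule: infinite_finite_induct) auto
  define T where "T = (\<lambda>(k, b) k'. if k' = k then b else (0::'c)) ` (K \<times> Basis)"
  have "finite T" using K by (simp add: T_def)
  have subX: "V.subspace X"
    using zero add scale by (intro V.subspaceI) (auto simp: plus_fun_def zero_fun_def)
  have "X \<subseteq> V.span T"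
  proof
    fix g assume g: "g \<in> X"
    have "g = (\<Sum>(k, b)\<in>K \<times> Basis. ?s (g k \<bullet> b) (\<lambda>k'. if k' = k then b else 0))"
    proof
      fix k
      have "(\<Sum>(k', b)\<in>K \<times> Basis. ?s (g k' \<bullet> b) (\<lambda>k''. if k'' = k' then b else 0)) k
        = (\<Sum>k'\<in>K. \<Sum>b\<in>Basis. if k = k' then (g k' \<bullet> b) *\<^sub>R b else 0)"
        by (auto simp: sum_apply sum.cartesian_product split_def intro!: sum.cong)
      also have "\<dots> = (\<Sum>k'\<in>K. if k = k' then g k' else 0)"
        by (intro sum.cong) (auto simp: euclidean_representation)
      also have "\<dots> = g k"
        using K supp[OF g] by auto
      finally show "g k = (\<Sum>(k', b)\<in>K \<times> Basis. ?s (g k' \<bullet> b) (\<lambda>k''. if k'' = k' then b else 0)) k" ..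
    qed
    also have "\<dots> \<in> V.span T"
      by (intro V.span_sum, clarify, intro V.span_scale V.span_base) (auto simp: T_def image_iff)
    finally show "g \<in> V.span T" .
  qed
  obtain B where B: "B \<subseteq> X" "V.independent B" "X \<subseteq> V.span B"
    using V.maximal_independent_subset by blast
  have finB: "finite B"
    using V.independent_span_bound[OF \<open>finite T\<close> B(2)] B(1) \<open>X \<subseteq> V.span T\<close> by auto
  obtain e where e: "bij_betw e {..<card B} B"
    using ex_bij_betw_nat_finite[OF finB] by (auto simp: atLeast0LessThan)
  have sum_e: "(\<lambda>k. \<Sum>i<card B. x i *\<^sub>R e i k) = (\<Sum>i<card B. ?s (x i) (e i))" for x
    by (simp add: fun_eq_iff sum_apply)
  show ?thesis
  proof (intro exI[of _ "card B"] exI[of _ e] conjI allI ballI impI)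
    show "(\<lambda>k. \<Sum>i<card B. x i *\<^sub>R e i k) \<in> X" for x
      unfolding sum_e using bij_betwE[OF e] B(1)
      by (intro V.subspace_sum[OF subX] V.subspace_scale[OF subX]) auto
    show "\<exists>x. g = (\<lambda>k. \<Sum>i<card B. x i *\<^sub>R e i k)" if g: "g \<in> X" for g
    proof -
      obtain u where "g = (\<Sum>v\<in>B. ?s (u v) v)"
        using g B(3) V.span_finite[OF finB] by auto
      also have "\<dots> = (\<Sum>i<card B. ?s (u (e i)) (e i))"
        by (rule sum.reindex_bij_betw[OF e, symmetric])
      finally have "g = (\<lambda>k. \<Sum>i<card B. u (e i) *\<^sub>R e i k)"
        unfolding sum_e .
      then show ?thesis by (intro exI)
    qed
    show "x i = 0" if "\<forall>k. (\<Sum>i<card B. x i *\<^sub>R e i k) = 0" "i < card B" for x i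
    proof -
      \<comment> \<open>Coefficients carried over to the basis vectors, since dependence of
        \<open>B\<close> is expressed by functions on \<open>B\<close> and not on indices.\<close>
      let ?u = "\<lambda>v. x (inv_into {..<card B} e v)"
      have inv: "inv_into {..<card B} e (e j) = j" if "j < card B" for j
        using that e by (simp add: bij_betw_def inv_into_f_f)
      have "(\<Sum>v\<in>B. ?s (?u v) v) = (\<Sum>i<card B. ?s (?u (e i)) (e i))"
        by (rule sum.reindex_bij_betw[OF e, symmetric])
      also have "\<dots> = (\<Sum>i<card B. ?s (x i) (e i))"
        by (intro sum.cong) (auto simp: inv)
      also have "\<dots> = 0"
        using that(1) unfolding sum_e[symmetric] by (simp add: zero_fun_def)
      finally have 0: "(\<Sum>v\<in>B. ?s (?u v) v) = 0" .
      have "?u (e i) = 0"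
      proof (rule ccontr)
        assume "?u (e i) \<noteq> 0"
        with 0 have "V.dependent B"
          using bij_betwE[OF e] that(2) unfolding V.dependent_finite[OF finB]
          by (intro exI[of _ ?u]) auto
        with B(2) show False ..
      qed
      then show "x i = 0"
        using inv[OF that(2)] by simp
    qed
  qed
qed

section \<open>Solvability of the algebraic system\<close>

lemma powr_field_inner: "(norm v powr (r - 2) *\<^sub>R v) \<bullet> v = norm v powr r"
proof (cases "v = 0")
  case False
  then have "norm v powr r = norm v powr (r - 2) * norm v powr 2"
    using powr_add[of "norm v" "r - 2" 2] by (simp del: powr_numeral)
  then show ?thesis
    using False by (simp add: dot_square_norm)
qed simp

text \<open>Only zeros of \<open>q\<close> are delicate: there the scalar factor may blow up nearby,
  but the product has norm \<open>norm v powr (r - 1)\<close>, which tends to 0 because r >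
  1.\<close>

lemma continuous_power_field:
  fixes q :: "'b::topological_space \<Rightarrow> 'a::euclidean_space"
  assumes r: "1 < r" and q: "continuous_on S q"
  shows "continuous_on S (\<lambda>x. norm (q x) powr (r - 2) *\<^sub>R q x)"
proof -
  have "isCont (\<lambda>v::'a. norm v powr (r - 2) *\<^sub>R v) v" for v
  proof (cases "v = 0")
    case False
    then show ?thesis
      by (intro continuous_intros) auto
  next
    case True
    have "norm (norm v powr (r - 2) *\<^sub>R v) = norm v powr (r - 1)" for v :: 'a
      using powr_add[of "norm v" "r - 2" 1] by (cases "v = 0") auto
    moreover have "((\<lambda>v::'a. norm v powr (r - 1)) \<longlongrightarrow> 0) (at 0)"
      using r by (auto intro!: tendsto_zero_powrI tendsto_norm_zero)
    ultimately show ?thesis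
      using True by (auto simp: isCont_def intro: tendsto_norm_zero_cancel)
  qed
  then have "continuous_on UNIV (\<lambda>v::'a. norm v powr (r - 2) *\<^sub>R v)"
    by (simp add: continuous_on_eq_continuous_at)
  then show ?thesis
    using continuous_on_compose2[OF _ q] by fastforce
qed

text \<open>
  A local state \<open>(c, a, b)\<close> stands for the value \<open>c\<close> of a piecewise constant function and the
  field \<open>x \<mapsto> a + b x\<close> on one element.
\<close>

definition rt_val :: "real \<times> 'a::euclidean_space \<times> real \<Rightarrow> 'a \<Rightarrow> 'a" where
  "rt_val c x = fst (snd c) + snd (snd c) *\<^sub>R x"

definition rt_div :: "real \<times> 'a::euclidean_space \<times> real \<Rightarrow> real" where
  "rt_div c = real DIM('a) * snd (snd c)"

lemma rt_sum:
  "rt_val (\<Sum>i\<in>I. c i *\<^sub>R h i) x = (\<Sum>i\<in>I. c i *\<^sub>R rt_val (h i) x)"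
  "rt_div (\<Sum>i\<in>I. c i *\<^sub>R h i) = (\<Sum>i\<in>I. c i * rt_div (h i))"
  by (simp_all add: rt_val_def rt_div_def fst_sum snd_sum sum.distrib scaleR_sum_left
      sum_distrib_left algebra_simps)

text \<open>
  Both equations of a time step at the state \<open>g\<close>, tested with \<open>h\<close>, multiplied by the step size
  and added up: on the element \<open>k\<close>, \<open>\<alpha> k\<close> is the volume, \<open>\<beta> k\<close> the quadrature weight, \<open>\<mu> k\<close> the
  coefficient as a function of the local value of \<open>W\<close>, and \<open>b k\<close> collects the data. In \<open>h = g\<close> the
  two terms with a divergence cancel.
\<close>

definition step_form ::
    "'k set \<Rightarrow> ('k \<Rightarrow> 'a set) \<Rightarrow> ('k \<Rightarrow> real) \<Rightarrow> ('k \<Rightarrow> real) \<Rightarrow> ('k \<Rightarrow> real \<Rightarrow> real) \<Rightarrow> ('k \<Rightarrow> real) \<Rightarrow> real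
      \<Rightarrow> real \<Rightarrow> ('k \<Rightarrow> real \<times> 'a::euclidean_space \<times> real) \<Rightarrow> ('k \<Rightarrow> real \<times> 'a \<times> real) \<Rightarrow> real" where
  "step_form K V \<alpha> \<beta> \<mu> b \<tau> r g h =
    (\<Sum>k\<in>K. \<alpha> k * fst (g k) * fst (h k) + \<tau> * \<alpha> k * rt_div (g k) * fst (h k) - b k * fst (h k)
      + \<tau> * \<beta> k * \<mu> k (fst (g k)) *
          (\<Sum>x\<in>V k. (norm (rt_val (g k) x) powr (r - 2) *\<^sub>R rt_val (g k) x) \<bullet> rt_val (h k) x)
      - \<tau> * \<alpha> k * fst (g k) * rt_div (h k))"

text \<open>The nonlinearity sits in the first state alone. Linearity in the test state makes
  testing with a basis sufficient, and identifies the pairing of the coordinate field with its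
  argument as \<open>step_form\<close> at equal arguments.\<close>

lemma step_form_sum_right:
  fixes h :: "'i \<Rightarrow> 'k \<Rightarrow> real \<times> 'a::euclidean_space \<times> real"
  shows "step_form K V \<alpha> \<beta> \<mu> b \<tau> r g (\<lambda>k. \<Sum>i\<in>I. c i *\<^sub>R h i k)
       = (\<Sum>i\<in>I. c i * step_form K V \<alpha> \<beta> \<mu> b \<tau> r g (h i))"
proof -
  have **: "(\<Sum>x\<in>V k. u x \<bullet> (\<Sum>i\<in>I. c i *\<^sub>R rt_val (h i k) x))
      = (\<Sum>i\<in>I. c i * (\<Sum>x\<in>V k. u x \<bullet> rt_val (h i k) x))" for k u
    by (simp add: inner_sum_right sum_distrib_left) (rule sum.swap)
  have ***: "p * (\<Sum>i\<in>I. c i * w i) + s * (\<Sum>i\<in>I. c i * w i) - t * (\<Sum>i\<in>I. c i * w i) + u * (\<Sum>i\<in>I. c i * y i)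
      - v * (\<Sum>i\<in>I. c i * z i) = (\<Sum>i\<in>I. c i * (p * w i + s * w i - t * w i + u * y i - v * z i))"
    for p s t u v :: real and w y z
    by (simp add: sum_distrib_left sum.distrib sum_subtractf algebra_simps)
  show ?thesis
    unfolding step_form_def fst_sum rt_sum ** fst_scaleR real_scaleR_def
    unfolding ***
    unfolding sum_distrib_left[of "c _"]
    by (rule sum.swap)
qed

text \<open>In coordinates of a basis \<open>e\<close> of \<open>X\<close> the equations are the
  field with components \<open>step_form ... (g x) (e i)\<close>. The hypothesis \<open>inj\<close>
  says that vertex values determine the local field, so the energy vanishes only at the zero
  state.\<close>

lemma discrete_step_solvable:
  fixes X :: "('k \<Rightarrow> real \<times> 'a::euclidean_space \<times> real) set" and V :: "'k \<Rightarrow> 'a set"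
  assumes K: "finite K"
    and supp: "\<And>g k. g \<in> X \<Longrightarrow> k \<notin> K \<Longrightarrow> g k = 0"
    and zero: "(\<lambda>k. 0) \<in> X"
    and add: "\<And>g h. g \<in> X \<Longrightarrow> h \<in> X \<Longrightarrow> (\<lambda>k. g k + h k) \<in> X"
    and scale: "\<And>c g. g \<in> X \<Longrightarrow> (\<lambda>k. c *\<^sub>R g k) \<in> X"
    and inj: "\<And>k c. k \<in> K \<Longrightarrow> fst c = 0 \<Longrightarrow> (\<And>x. x \<in> V k \<Longrightarrow> rt_val c x = 0) \<Longrightarrow> c = 0"
    and V: "\<And>k. k \<in> K \<Longrightarrow> finite (V k)"
    and \<alpha>: "\<And>k. k \<in> K \<Longrightarrow> \<alpha> k > 0" and \<beta>: "\<And>k. k \<in> K \<Longrightarrow> \<beta> k > 0"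
    and \<mu>: "\<And>k. k \<in> K \<Longrightarrow> continuous_on UNIV (\<mu> k)" "\<And>k s. k \<in> K \<Longrightarrow> \<mu> k s \<ge> k0"
    and pos: "k0 > 0" "\<tau> > 0" and r: "1 < r" "r < 2"
  shows "\<exists>g\<in>X. \<forall>h\<in>X. step_form K V \<alpha> \<beta> \<mu> b \<tau> r g h = 0"
proof -
  have "\<exists>(m::nat) e. (\<forall>x. (\<lambda>k. \<Sum>i<m. x i *\<^sub>R e i k) \<in> X) \<and>
    (\<forall>g\<in>X. \<exists>x. g = (\<lambda>k. \<Sum>i<m. x i *\<^sub>R e i k)) \<and>
    (\<forall>x. (\<forall>k. (\<Sum>i<m. x i *\<^sub>R e i k) = 0) \<longrightarrow> (\<forall>i<m. x i = 0))"
    by (rule finite_basis_of_finitely_supported[OF K]) (fact supp zero add scale)+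
  then obtain m :: nat and e :: "nat \<Rightarrow> 'k \<Rightarrow> real \<times> 'a \<times> real"
    where eX: "\<forall>x. (\<lambda>k. \<Sum>i<m. x i *\<^sub>R e i k) \<in> X"
    and espan: "\<forall>g\<in>X. \<exists>x. g = (\<lambda>k. \<Sum>i<m. x i *\<^sub>R e i k)"
    and eind: "\<forall>x. (\<forall>k. (\<Sum>i<m. x i *\<^sub>R e i k) = 0) \<longrightarrow> (\<forall>i<m. x i = 0)"
    by (elim exE conjE)
  define g where "g = (\<lambda>x k. \<Sum>i<m. x i *\<^sub>R e i k)"
  let ?B = "step_form K V \<alpha> \<beta> \<mu> b \<tau> r"
  let ?E = "{x::nat \<Rightarrow> real. \<forall>j\<ge>m. x j = 0}"
  have scale_fst: "fst (g (\<lambda>j. R * x j) k) = R * fst (g x k)"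
    and scale_rt: "rt_val (g (\<lambda>j. R * x j) k) v = R *\<^sub>R rt_val (g x k) v" for R x k v
  proof -
    have "g (\<lambda>j. R * x j) k = R *\<^sub>R g x k"
      by (simp add: g_def scaleR_sum_right)
    then show "fst (g (\<lambda>j. R * x j) k) = R * fst (g x k)" 
      "rt_val (g (\<lambda>j. R * x j) k) v = R *\<^sub>R rt_val (g x k) v"
      by (simp_all add: rt_val_def algebra_simps)
  qed
  have gc: "continuous_on ?E (\<lambda>x. g x k)" for k
    unfolding g_def
    by (intro continuous_on_sum continuous_on_scaleR continuous_on_const
        continuous_on_subset[OF continuous_on_product_coordinates subset_UNIV])
  have fgc: "continuous_on ?E (\<lambda>x. fst (g x k))" for k
    by (intro continuous_intros gc)
  have dgc: "continuous_on ?E (\<lambda>x. rt_div (g x k))" for k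
    unfolding rt_div_def by (intro continuous_intros gc)
  have vgc: "continuous_on ?E (\<lambda>x. rt_val (g x k) v)" for k v
    unfolding rt_val_def by (intro continuous_intros gc)
  have npc: "continuous_on ?E (\<lambda>x. norm (rt_val (g x k) v) powr r)" for k v
    by (rule continuous_on_powr'[OF continuous_on_norm[OF vgc] continuous_on_const]) (use r in auto)
  have \<mu>c: "continuous_on ?E (\<lambda>x. \<mu> k (fst (g x k)))" if "k \<in> K" for k
    by (rule continuous_on_compose2[OF \<mu>(1)[OF that] fgc]) auto
  \<comment> \<open>The energy with the coefficient lowered to \<open>k0\<close>: the true
    coefficient varies with R along a ray and could not be factored out. \<open>H\<close> is the
    data term.\<close>
  define G where "G = (\<lambda>x. \<Sum>k\<in>K. \<alpha> k * (fst (g x k))\<^sup>2 + \<tau> * \<beta> k * k0 * (\<Sum>v\<in>V k. norm (rt_val (g x k) v) powr r))"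
  define H where "H = (\<lambda>x. \<Sum>k\<in>K. b k * fst (g x k))"
  have "\<exists>x\<in>?E. \<forall>i<m. ?B (g x) (e i) = 0"
  proof (rule homogeneously_coercive_field_has_zero
      [where F = "\<lambda>x i. ?B (g x) (e i)" and G = G and H = H and r = r and m = m])
    show "continuous_on ?E (\<lambda>x. ?B (g x) (e i))" for i
      unfolding step_form_def
      by (intro continuous_on_sum continuous_on_diff continuous_on_add continuous_on_mult
          continuous_on_inner continuous_on_const fgc dgc \<mu>c continuous_power_field[OF r(1)] vgc)
    show "continuous_on ?E G"
      unfolding G_def
      by (intro continuous_on_sum continuous_on_add continuous_on_mult continuous_on_power
          continuous_on_const fgc npc)
    show "continuous_on ?E H"
      unfolding H_def by (intro continuous_on_sum continuous_on_mult continuous_on_const fgc)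
    show "r > 1" by fact
    show "G x > 0" if x: "x \<in> ?E" "(\<Sum>i<m. (x i)\<^sup>2) = 1" for x
    proof (rule ccontr)
      assume "\<not> G x > 0"
      moreover have nn: "\<alpha> k * (fst (g x k))\<^sup>2 + \<tau> * \<beta> k * k0 * (\<Sum>v\<in>V k. norm (rt_val (g x k) v) powr r) \<ge> 0"
        if "k \<in> K" for k
        using \<alpha>[OF that] \<beta>[OF that] pos by (intro add_nonneg_nonneg mult_nonneg_nonneg sum_nonneg) auto
      ultimately have "G x = 0"
        unfolding G_def by (intro antisym sum_nonneg) auto
      then have 0: "\<alpha> k * (fst (g x k))\<^sup>2 + \<tau> * \<beta> k * k0 * (\<Sum>v\<in>V k. norm (rt_val (g x k) v) powr r) = 0" if "k \<in> K" for k
        using K nn that unfolding G_def by (subst (asm) sum_nonneg_eq_0_iff) auto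
      have "g x k = 0" for k
      proof (cases "k \<in> K")
        case True
        have n: "\<alpha> k * (fst (g x k))\<^sup>2 \<ge> 0" "\<tau> * \<beta> k * k0 * (\<Sum>v\<in>V k. norm (rt_val (g x k) v) powr r) \<ge> 0"
          using \<alpha>[OF True] \<beta>[OF True] pos by (intro mult_nonneg_nonneg sum_nonneg; simp)+
        have "\<alpha> k * (fst (g x k))\<^sup>2 = 0" "\<tau> * \<beta> k * k0 * (\<Sum>v\<in>V k. norm (rt_val (g x k) v) powr r) = 0"
          using 0[OF True] n by linarith+
        then have "fst (g x k) = 0" "(\<Sum>v\<in>V k. norm (rt_val (g x k) v) powr r) = 0"
          using \<alpha>[OF True] \<beta>[OF True] pos by auto
        then show ?thesis
          using V[OF True] by (intro inj[OF True]) (auto simp: sum_nonneg_eq_0_iff)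
      next
        case False
        then show ?thesis using supp eX unfolding g_def by blast
      qed
      then have "x i = 0" if "i < m" for i
        using eind that by (simp add: g_def)
      with x(2) show False by simp
    qed
    show "(\<Sum>i<m. ?B (g (\<lambda>j. R * x j)) (e i) * (R * x i)) \<ge> R powr r * G x - R * H x"
      if R: "R \<ge> 1" and x: "x \<in> ?E" for R x
    proof -
      let ?y = "\<lambda>j. R * x j"
      have "(\<Sum>i<m. ?B (g ?y) (e i) * (R * x i)) = ?B (g ?y) (g ?y)"
      proof -
        have "g ?y = (\<lambda>k. \<Sum>i<m. (R * x i) *\<^sub>R e i k)" by (simp add: g_def)
        then have "?B (g ?y) (g ?y) = ?B (g ?y) (\<lambda>k. \<Sum>i<m. (R * x i) *\<^sub>R e i k)" by simp
        also have "\<dots> = (\<Sum>i<m. ?B (g ?y) (e i) * (R * x i))"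
          by (subst step_form_sum_right) (simp add: mult.commute)
        finally show ?thesis ..
      qed
      also have "\<dots> = (\<Sum>k\<in>K. \<alpha> k * (R * fst (g x k))\<^sup>2 - R * (b k * fst (g x k))
          + \<tau> * \<beta> k * \<mu> k (R * fst (g x k)) * (\<Sum>v\<in>V k. norm (R *\<^sub>R rt_val (g x k) v) powr r))"
      proof -
        show ?thesis
          unfolding step_form_def scale_fst scale_rt powr_field_inner
          by (intro sum.cong refl) (simp add: power2_eq_square)
      qed
      also have "\<dots> \<ge> (\<Sum>k\<in>K. \<alpha> k * (R powr r * (fst (g x k))\<^sup>2) - R * (b k * fst (g x k))
          + \<tau> * \<beta> k * k0 * (\<Sum>v\<in>V k. R powr r * norm (rt_val (g x k) v) powr r))"
      proof (intro sum_mono add_mono diff_mono order_refl)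
        fix k assume k: "k \<in> K"
        \<comment> \<open>The point where r < 2 and R \<ge> 1 meet: the quadratic growth of the W
          part is lowered to the growth of the flux part.\<close>
        have "R powr r \<le> R\<^sup>2"
          using R r powr_mono[of r 2 R] by simp
        then show "\<alpha> k * (R powr r * (fst (g x k))\<^sup>2) \<le> \<alpha> k * (R * fst (g x k))\<^sup>2"
          using \<alpha>[OF k] by (auto simp: power_mult_distrib intro!: mult_left_mono mult_right_mono)
        have "(\<Sum>v\<in>V k. R powr r * norm (rt_val (g x k) v) powr r) = (\<Sum>v\<in>V k. norm (R *\<^sub>R rt_val (g x k) v) powr r)"
          using R by (intro sum.cong) (auto simp: powr_mult)
        then show "\<tau> * \<beta> k * k0 * (\<Sum>v\<in>V k. R powr r * norm (rt_val (g x k) v) powr r)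
          \<le> \<tau> * \<beta> k * \<mu> k (R * fst (g x k)) * (\<Sum>v\<in>V k. norm (R *\<^sub>R rt_val (g x k) v) powr r)"
          using \<beta>[OF k] \<mu>(2)[OF k] pos by (auto intro!: mult_right_mono mult_left_mono sum_nonneg)
      qed
      also have "(\<Sum>k\<in>K. \<alpha> k * (R powr r * (fst (g x k))\<^sup>2) - R * (b k * fst (g x k))
          + \<tau> * \<beta> k * k0 * (\<Sum>v\<in>V k. R powr r * norm (rt_val (g x k) v) powr r)) = R powr r * G x - R * H x"
        unfolding G_def H_def sum_distrib_left sum_subtractf[symmetric]
        by (intro sum.cong refl) (simp add: algebra_simps sum_distrib_left)
      finally show ?thesis .
    qed
  qed
  then obtain x where x: "\<And>i. i < m \<Longrightarrow> ?B (g x) (e i) = 0" by auto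
  have "?B (g x) h = 0" if h: "h \<in> X" for h
  proof -
    obtain y where "h = (\<lambda>k. \<Sum>i<m. y i *\<^sub>R e i k)" using espan h by blast
    then show ?thesis
      using x by (simp add: step_form_sum_right)
  qed
  moreover have "g x \<in> X" using eX by (simp add: g_def)
  ultimately show ?thesis by blast
qed

section \<open>Geometry of the mesh\<close>

text \<open>Differences to one chosen point of \<open>C\<close> are linearly independent, so a
  linear functional with the prescribed increments exists; \<open>b\<close> is its representing
  vector.\<close>

lemma affine_interpolation:
  fixes C :: "'a::euclidean_space set"
  assumes "\<not> affine_dependent C"
  obtains a b where "\<And>x. x \<in> C \<Longrightarrow> w x = a + b \<bullet> x"
proof (cases "C = {}")
  case False
  then obtain p where p: "p \<in> C" by blast
  have "independent ((\<lambda>x. -p + x) ` (C - {p}))"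
    using assms affine_dependent_iff_dependent2[OF p] by simp
  then obtain g where g: "linear g" "\<forall>x\<in>(\<lambda>x. -p + x) ` (C - {p}). g x = w (p + x) - w p"
    using linear_independent_extend[of _ "\<lambda>x. w (p + x) - w p"] by blast
  define b where "b = (\<Sum>i\<in>Basis. g i *\<^sub>R i)"
  have gb: "g x = b \<bullet> x" for x
  proof -
    have "g x = g (\<Sum>i\<in>Basis. (x \<bullet> i) *\<^sub>R i)" by (simp add: euclidean_representation)
    also have "\<dots> = b \<bullet> x"
      by (auto simp: linear_sum[OF g(1)] linear_scale[OF g(1)] b_def inner_sum_left inner_commute[of x] intro!: sum.cong)
    finally show ?thesis .
  qed
  have "w x = (w p - b \<bullet> p) + b \<bullet> x" if "x \<in> C" for x
  proof (cases "x = p")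
    case False
    then have "g (-p + x) = w x - w p" using g(2) that by auto
    then show ?thesis by (simp add: gb inner_diff_right)
  qed simp
  then show ?thesis by (rule that)
qed (auto intro: that)

text \<open>Every point of the closure of an open set is a limit point of it, so the limit from
  within is unique. One-sided values of a piecewise function are thereby read off from a continuous
  extension.\<close>

lemma inner_value_eq:
  fixes \<sigma> :: "'a::euclidean_space set"
  assumes "open \<sigma>" "x \<in> closure \<sigma>" "\<And>y. y \<in> \<sigma> \<Longrightarrow> v y = g y" "isCont g x"
  shows "inner_value \<sigma> v x = g x"
proof -
  have "x islimpt \<sigma>"
    using assms(1,2) open_imp_islimpt by (auto simp: closure_def)
  then have nt: "at x within \<sigma> \<noteq> bot"
    by (simp add: trivial_limit_within)
  have "(g \<longlongrightarrow> g x) (at x within \<sigma>)"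
    using assms(4) unfolding isCont_def by (rule tendsto_within_subset) simp
  then have "(v \<longlongrightarrow> g x) (at x within \<sigma>)"
    by (rule Lim_transform_eventually) (auto simp: eventually_at_filter assms(3))
  then show ?thesis
    unfolding inner_value_def using nt by (intro tendsto_Lim)
qed

lemma divergence_affine:
  fixes v :: "'a::euclidean_space \<Rightarrow> 'a"
  assumes "open \<sigma>" "x \<in> \<sigma>" "\<And>y. y \<in> \<sigma> \<Longrightarrow> v y = a + b *\<^sub>R y"
  shows "divergence v x = real DIM('a) * b"
proof -
  have "((\<lambda>y. a + b *\<^sub>R y) has_derivative (\<lambda>y. b *\<^sub>R y)) (at x)"
    by (auto intro!: derivative_eq_intros)
  then have "(v has_derivative (\<lambda>y. b *\<^sub>R y)) (at x)"
    by (rule has_derivative_transform_within_open[OF _ assms(1,2)]) (simp add: assms(3))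
  then have "frechet_derivative v (at x) = (\<lambda>y. b *\<^sub>R y)"
    by (rule frechet_derivative_at[symmetric])
  then show ?thesis
    by (simp add: divergence_def)
qed

lemma grad_affine:
  fixes u :: "'a::euclidean_space \<Rightarrow> real"
  assumes "open \<sigma>" "x \<in> \<sigma>" "\<And>y. y \<in> \<sigma> \<Longrightarrow> u y = a + b \<bullet> y"
  shows "grad u x = b"
proof -
  have "((\<lambda>y. a + b \<bullet> y) has_derivative (\<lambda>y. b \<bullet> y)) (at x)"
    by (auto intro!: derivative_eq_intros)
  then have "(u has_derivative (\<lambda>y. b \<bullet> y)) (at x)"
    by (rule has_derivative_transform_within_open[OF _ assms(1,2)]) (simp add: assms(3))
  then have "frechet_derivative u (at x) = (\<lambda>y. b \<bullet> y)"
    by (rule frechet_derivative_at[symmetric])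
  then show ?thesis
    by (simp add: grad_def euclidean_representation)
qed

section \<open>Elements, skeleton and vertices of a conforming mesh\<close>

locale mesh =
  fixes \<Omega> :: "'a::euclidean_space set" and \<T> :: "'a set set"
  assumes domain: "convex_polygonal_domain \<Omega>"
    and partition: "conforming_partition \<Omega> \<T>"
begin

lemma element:
  assumes "\<sigma> \<in> \<T>"
  shows "int DIM('a) simplex closure \<sigma>" "interior (closure \<sigma>) = \<sigma>"
  using assms partition by (auto simp: conforming_partition_def)

lemma element_open: "\<sigma> \<in> \<T> \<Longrightarrow> open \<sigma>"
  by (metis element(2) open_interior)

lemma element_convex: "\<sigma> \<in> \<T> \<Longrightarrow> convex \<sigma>"
  by (metis convex_interior convex_simplex element)

lemma element_bounded: "\<sigma> \<in> \<T> \<Longrightarrow> bounded \<sigma>"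
  by (metis bounded_subset closure_subset compact_imp_bounded compact_simplex element(1))

text \<open>Full dimension makes the relative interior of the closed simplex its interior, and a
  nonempty convex set has nonempty relative interior.\<close>

lemma element_nonempty:
  assumes "\<sigma> \<in> \<T>"
  shows "\<sigma> \<noteq> {}"
proof -
  have "aff_dim (closure \<sigma>) = int DIM('a)"
    using aff_dim_simplex[OF element(1)[OF assms]] .
  then have "rel_interior (closure \<sigma>) = \<sigma>" "closure \<sigma> \<noteq> {}"
    using rel_interior_interior[of "closure \<sigma>"] element(2)[OF assms]
    by (auto simp: aff_dim_eq_full)
  then show ?thesis by auto
qed

lemma element_lmeasurable: "\<sigma> \<in> \<T> \<Longrightarrow> \<sigma> \<in> lmeasurable"
  by (simp add: element_bounded element_open lmeasurable_open)

lemma measure_element_pos: "\<sigma> \<in> \<T> \<Longrightarrow> measure lebesgue \<sigma> > 0"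
  using negligible_iff_measure0[OF element_lmeasurable, of \<sigma>] open_not_negligible[of \<sigma>]
    element_open[of \<sigma>] element_nonempty[of \<sigma>] zero_less_measure_iff by metis

text \<open>The triangulation consists of closures; an element is recovered from its closure as the
  interior, so finiteness transfers.\<close>

lemma finite_elements: "finite \<T>"
proof -
  have "finite (closure ` \<T>)"
    using partition by (simp add: conforming_partition_def triangulation_def)
  moreover have "inj_on closure \<T>"
    by (intro inj_onI) (metis element(2))
  ultimately show ?thesis by (rule finite_imageD)
qed

lemma element_eq: "\<sigma> \<in> \<T> \<Longrightarrow> \<sigma>' \<in> \<T> \<Longrightarrow> x \<in> \<sigma> \<Longrightarrow> x \<in> \<sigma>' \<Longrightarrow> \<sigma> = \<sigma>'"
  using partition unfolding conforming_partition_def by (metis disjnt_iff pairwiseD)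

lemma open_domain: "open \<Omega>" and bounded_domain: "bounded \<Omega>"
  and convex_domain: "convex \<Omega>" and nonempty_domain: "\<Omega> \<noteq> {}"
  using domain by (auto simp: convex_polygonal_domain_def)

lemma lmeasurable_domain: "\<Omega> \<in> lmeasurable"
  by (simp add: bounded_domain lmeasurable_open open_domain)

lemma closure_domain: "closure \<Omega> = (\<Union>\<sigma>\<in>\<T>. closure \<sigma>)"
  using partition by (simp add: conforming_partition_def)

text \<open>A convex open set is the interior of its closure, so inclusion of closures passes to the
  open sets.\<close>

lemma element_subset: "\<sigma> \<in> \<T> \<Longrightarrow> \<sigma> \<subseteq> \<Omega>"
proof -
  assume \<sigma>: "\<sigma> \<in> \<T>"
  then have "\<sigma> \<subseteq> interior (closure \<Omega>)"
    using element(2)[OF \<sigma>] closure_domain interior_mono[of "closure \<sigma>" "closure \<Omega>"] by auto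
  then show ?thesis
    using convex_interior_closure[OF convex_domain] open_domain by (simp add: interior_open)
qed

text \<open>A point of the domain outside all elements lies on the frontier of one of finitely many
  convex sets, each a null set.\<close>

lemma negligible_skeleton: "negligible (\<Omega> - \<Union>\<T>)"
proof (rule negligible_subset)
  show "negligible (\<Union>\<sigma>\<in>\<T>. frontier \<sigma>)"
    using finite_elements element_convex
    by (intro negligible_Union) (auto intro: negligible_convex_frontier)
  show "\<Omega> - \<Union>\<T> \<subseteq> (\<Union>\<sigma>\<in>\<T>. frontier \<sigma>)"
    using closure_domain closure_subset[of \<Omega>] element_open
    by (force simp: frontier_def interior_open)
qed

text \<open>\<open>vertices\<close> speaks of extreme points, \<open>simplex\<close> of some
  affinely independent generating set; for such a set all generators, and nothing else, are extreme
  in the hull.\<close>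

lemma vertices_element:
  assumes "\<sigma> \<in> \<T>"
  shows "closure \<sigma> = convex hull vertices \<sigma>" "\<not> affine_dependent (vertices \<sigma>)"
    "finite (vertices \<sigma>)" "card (vertices \<sigma>) = DIM('a) + 1"
proof -
  obtain C where C: "\<not> affine_dependent C" "int (card C) = int DIM('a) + 1" "closure \<sigma> = convex hull C"
    using element(1)[OF assms] by (auto simp: simplex_def)
  have "vertices \<sigma> = C"
    unfolding vertices_def C(3) using extreme_point_of_convex_hull_affine_independent[OF C(1)] by blast
  with C show "closure \<sigma> = convex hull vertices \<sigma>" "\<not> affine_dependent (vertices \<sigma>)"
    "finite (vertices \<sigma>)" "card (vertices \<sigma>) = DIM('a) + 1"
    by (auto simp: aff_independent_finite)
qed

lemma vertices_subset: "\<sigma> \<in> \<T> \<Longrightarrow> vertices \<sigma> \<subseteq> closure \<sigma>"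
  by (auto simp: vertices_def extreme_point_of_def)

lemma closure_element_subset: "\<sigma> \<in> \<T> \<Longrightarrow> closure \<sigma> \<subseteq> closure \<Omega>"
  using closure_domain by blast

text \<open>
  The affine interpolants on two elements agree at the vertices of their common face, hence on
  the face, so they glue to a continuous function.
\<close>

lemma nodal_interpolant_exists:
  "\<exists>u. u \<in> U_space \<Omega> \<T> \<and> (\<forall>\<sigma>\<in>\<T>. \<forall>x\<in>vertices \<sigma>. u x = w x)"
proof -
  have "\<forall>\<sigma>\<in>\<T>. \<exists>ab. \<forall>x\<in>vertices \<sigma>. w x = fst ab + snd ab \<bullet> x"
    by (metis affine_interpolation vertices_element(2) fst_conv snd_conv)
  then obtain ab where ab: "\<And>\<sigma> x. \<sigma> \<in> \<T> \<Longrightarrow> x \<in> vertices \<sigma> \<Longrightarrow> w x = fst (ab \<sigma>) + snd (ab \<sigma>) \<bullet> x"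
    by metis
  define l where "l \<sigma> x = fst (ab \<sigma>) + snd (ab \<sigma>) \<bullet> x" for \<sigma> x
  have agree: "l \<sigma> x = l \<sigma>' x" if \<sigma>: "\<sigma> \<in> \<T>" "\<sigma>' \<in> \<T>" and x: "x \<in> closure \<sigma>" "x \<in> closure \<sigma>'" for \<sigma> \<sigma>' x
  proof -
    let ?F = "closure \<sigma> \<inter> closure \<sigma>'"
    have F: "?F face_of closure \<sigma>" "?F face_of closure \<sigma>'"
      using partition \<sigma> unfolding conforming_partition_def triangulation_def
      by (metis image_eqI Int_commute)+
    have "compact ?F" "convex ?F"
      using compact_simplex[OF element(1)] convex_closure[OF element_convex] \<sigma>
      by (simp_all add: compact_Int convex_Int)
    then have "?F = convex hull {v. v extreme_point_of ?F}"
      by (rule Krein_Milman_Minkowski)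
    also have "\<dots> \<subseteq> {y. l \<sigma> y = l \<sigma>' y}"
    proof (rule hull_minimal)
      show "convex {y. l \<sigma> y = l \<sigma>' y}"
      proof -
        have "{y. l \<sigma> y = l \<sigma>' y} = {y. (snd (ab \<sigma>) - snd (ab \<sigma>')) \<bullet> y = fst (ab \<sigma>') - fst (ab \<sigma>)}"
          by (auto simp: l_def algebra_simps)
        then show ?thesis by (simp add: convex_hyperplane)
      qed
      show "{v. v extreme_point_of ?F} \<subseteq> {y. l \<sigma> y = l \<sigma>' y}"
      proof
        fix v assume "v \<in> {v. v extreme_point_of ?F}"
        then have v: "v extreme_point_of ?F"
 by simp
        then have "v \<in> vertices \<sigma>" "v \<in> vertices \<sigma>'"
          using extreme_point_of_face[OF F(1)] extreme_point_of_face[OF F(2)] by (auto simp: vertices_def)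
        then show "v \<in> {y. l \<sigma> y = l \<sigma>' y}"
          using ab[OF \<sigma>(1), of v] ab[OF \<sigma>(2), of v] unfolding l_def by simp
      qed
    qed
    finally show ?thesis using x by blast
  qed
  define u where "u x = l (SOME \<sigma>. \<sigma> \<in> \<T> \<and> x \<in> closure \<sigma>) x" for x
  have u: "u x = l \<sigma> x" if "\<sigma> \<in> \<T>" "x \<in> closure \<sigma>" for \<sigma> x
    unfolding u_def
  proof (rule someI2[of _ \<sigma>])
    show "\<sigma> \<in> \<T> \<and> x \<in> closure \<sigma>" using that by blast
    show "l \<sigma>' x = l \<sigma> x" if "\<sigma>' \<in> \<T> \<and> x \<in> closure \<sigma>'" for \<sigma>'
      by (rule agree) (use that \<open>\<sigma> \<in> \<T>\<close> \<open>x \<in> closure \<sigma>\<close> in blast)+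
  qed
  have "continuous_on (closure \<Omega>) u"
    unfolding closure_domain
  proof (rule continuous_on_closed_Union)
    show "continuous_on (closure \<sigma>) u" if "\<sigma> \<in> \<T>" for \<sigma>
    proof -
      have "continuous_on (closure \<sigma>) (l \<sigma>)"
        unfolding l_def by (intro continuous_intros)
      then show ?thesis
        using u[OF that] by (simp cong: continuous_on_cong)
    qed
  qed (use finite_elements in auto)
  moreover have "\<exists>a b. \<forall>x\<in>\<sigma>. u x = a + b \<bullet> x" if "\<sigma> \<in> \<T>" for \<sigma>
  proof -
    have "\<forall>x\<in>\<sigma>. u x = fst (ab \<sigma>) + snd (ab \<sigma>) \<bullet> x"
      using u[OF that] closure_subset[of \<sigma>] by (auto simp: l_def)
    then show ?thesis by blast
  qed
  moreover have "u x = w x" if "\<sigma> \<in> \<T>" "x \<in> vertices \<sigma>" for \<sigma> x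
  proof -
    have "x \<in> closure \<sigma>" using vertices_subset that by blast
    then show ?thesis using u[OF that(1)] ab[OF that] by (simp add: l_def)
  qed
  ultimately show ?thesis
    by (auto simp: U_space_def)
qed

lemma nodal_interp:
  "nodal_interp \<Omega> \<T> w \<in> U_space \<Omega> \<T>"
  "\<sigma> \<in> \<T> \<Longrightarrow> x \<in> vertices \<sigma> \<Longrightarrow> nodal_interp \<Omega> \<T> w x = w x"
  using someI_ex[OF nodal_interpolant_exists[of w]] unfolding nodal_interp_def by blast+

text \<open>Continuity extends the affine formula to the closed element, in particular to the
  vertices. The slab where an affine function is bounded by B is convex, so the bound spreads from
  the vertices to their hull.\<close>

lemma nodal_interp_bound:
  assumes "\<And>x. x \<in> closure \<Omega> \<Longrightarrow> \<bar>w x\<bar> \<le> B" "\<sigma> \<in> \<T>" "x \<in> \<sigma>"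
  shows "\<bar>nodal_interp \<Omega> \<T> w x\<bar> \<le> B"
proof -
  let ?u = "nodal_interp \<Omega> \<T> w"
  obtain a b where ab: "\<And>y. y \<in> \<sigma> \<Longrightarrow> ?u y = a + b \<bullet> y"
    using nodal_interp(1)[of w] assms(2) unfolding U_space_def by blast
  have cont: "continuous_on (closure \<sigma>) ?u"
    using nodal_interp(1)[of w] closure_element_subset[OF assms(2)] continuous_on_subset
    unfolding U_space_def by blast
  have cont': "continuous_on (closure \<sigma>) (\<lambda>y. ?u y - (a + b \<bullet> y))"
    by (intro continuous_intros cont)
  have eq: "?u y = a + b \<bullet> y" if "y \<in> closure \<sigma>" for y
    using continuous_constant_on_closure[OF cont', of 0 y] that ab by simp
  have "vertices \<sigma> \<subseteq> {y. \<bar>a + b \<bullet> y\<bar> \<le> B}"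
  proof clarify
    fix v assume v: "v \<in> vertices \<sigma>"
    then have "v \<in> closure \<sigma>" using vertices_subset[OF assms(2)] by blast
    then show "\<bar>a + b \<bullet> v\<bar> \<le> B"
      using eq[of v] nodal_interp(2)[OF assms(2) v, of w] assms(1)[of v] closure_element_subset[OF assms(2)]
      by auto
  qed
  moreover have "convex {y. \<bar>a + b \<bullet> y\<bar> \<le> B}"
  proof -
    have "{y. \<bar>a + b \<bullet> y\<bar> \<le> B} = {y. b \<bullet> y \<le> B - a} \<inter> {y. b \<bullet> y \<ge> - B - a}"
      by auto
    then show ?thesis by (simp add: convex_Int convex_halfspace_le convex_halfspace_ge)
  qed
  ultimately have "closure \<sigma> \<subseteq> {y. \<bar>a + b \<bullet> y\<bar> \<le> B}"
    unfolding vertices_element(1)[OF assms(2)] by (rule hull_minimal)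
  then show ?thesis
    using assms(3) ab[OF assms(3)] closure_subset[of \<sigma>] by auto
qed

end

section \<open>Discrete states and the time step\<close>

text \<open>The clamped form makes continuity in \<open>s\<close> and monotone interpolation between
  \<open>k1\<close> and \<open>k0\<close> evident, both hidden by the nested conditional.\<close>

lemma ramp_eq:
  fixes c k0 k1 s \<epsilon> :: real
  assumes "\<epsilon> > 0"
  shows "(if s \<ge> c + \<epsilon> then k0 else if s \<ge> c then k1 + (k0 - k1) * ((s - c) / \<epsilon>) else k1)
       = k1 + (k0 - k1) * max 0 (min 1 ((s - c) / \<epsilon>))"
proof -
  consider "s \<ge> c + \<epsilon>" | "c \<le> s" "s < c + \<epsilon>" | "s < c" by linarith
  then show ?thesis
  proof cases
    case 1
    then have "(s - c) / \<epsilon> \<ge> 1" using assms by (simp add: field_simps)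
    with 1 show ?thesis by simp
  next
    case 2
    then have "(s - c) / \<epsilon> \<ge> 0" "(s - c) / \<epsilon> < 1" using assms by (simp_all add: field_simps)
    with 2 show ?thesis by simp
  next
    case 3
    then have "(s - c) / \<epsilon> < 0" using assms by (simp add: field_simps)
    with 3 assms show ?thesis by simp
  qed
qed

context mesh
begin

section \<open>Integration element by element\<close>

lemma element_sets: "\<sigma> \<in> \<T> \<Longrightarrow> \<sigma> \<in> sets lebesgue"
  by (rule fmeasurableD[OF element_lmeasurable])

text \<open>The skeleton is null and the elements are finitely many, so the integrand may take any
  values between elements.\<close>

lemma set_integrable_mesh_iff:
  fixes u :: "'a \<Rightarrow> real"
  shows "set_integrable lebesgue \<Omega> u \<longleftrightarrow> (\<forall>\<sigma>\<in>\<T>. set_integrable lebesgue \<sigma> u)"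
proof -
  have "set_integrable lebesgue \<Omega> u \<longleftrightarrow> set_integrable lebesgue (\<Union>\<T>) u"
    using element_subset
    by (intro absolutely_integrable_spike_set_eq negligible_subset[OF negligible_skeleton]) auto
  also have "\<dots> \<longleftrightarrow> (\<forall>\<sigma>\<in>\<T>. set_integrable lebesgue \<sigma> u)"
  proof
    show "set_integrable lebesgue (\<Union>\<T>) u" if "\<forall>\<sigma>\<in>\<T>. set_integrable lebesgue \<sigma> u"
      using set_integrable_UN[where A = "\<lambda>\<sigma>. \<sigma>", OF finite_elements _ element_sets, of u] that by simp
    show "\<forall>\<sigma>\<in>\<T>. set_integrable lebesgue \<sigma> u" if "set_integrable lebesgue (\<Union>\<T>) u"
      using set_integrable_subset[OF that element_sets] by blast
  qed
  finally show ?thesis .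
qed

lemma set_integral_mesh:
  fixes u :: "'a \<Rightarrow> real"
  assumes "set_integrable lebesgue \<Omega> u"
  shows "(LINT x:\<Omega>|lebesgue. u x) = (\<Sum>\<sigma>\<in>\<T>. LINT x:\<sigma>|lebesgue. u x)"
proof -
  have int: "set_integrable lebesgue \<sigma> u" if "\<sigma> \<in> \<T>" for \<sigma>
    using assms that set_integrable_mesh_iff by blast
  have "set_integrable lebesgue (\<Union>\<T>) u"
    using set_integrable_UN[where A = "\<lambda>\<sigma>. \<sigma>", OF finite_elements int element_sets] by simp
  note set_lebesgue_integral_eq_integral(2)[OF this]
  moreover have "integral \<Omega> u = integral (\<Union>\<T>) u"
  proof (rule integral_spike_set)
    have "{x \<in> \<Union>\<T> - \<Omega>. u x \<noteq> 0} = {}" using element_subset by blast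
    then show "negligible {x \<in> \<Union>\<T> - \<Omega>. u x \<noteq> 0}" by (metis negligible_empty)
  qed (rule negligible_subset[OF negligible_skeleton], blast)
  ultimately have "(LINT x:\<Omega>|lebesgue. u x) = (LINT x:(\<Union>\<T>)|lebesgue. u x)"
    unfolding set_lebesgue_integral_eq_integral(2)[OF assms] by simp
  also have "\<dots> = (LINT x:(\<Union>\<sigma>\<in>\<T>. \<sigma>)|lebesgue. u x)"
    by simp
  also have "\<dots> = (\<Sum>\<sigma>\<in>\<T>. LINT x:\<sigma>|lebesgue. u x)"
  proof (rule set_integral_finite_Union[OF finite_elements])
    show "disjoint_family_on (\<lambda>\<sigma>. \<sigma>) \<T>"
      unfolding disjoint_family_on_def using element_eq by blast
  qed (rule int element_sets, assumption)+
  finally show ?thesis .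
qed

text \<open>On each element the factor is a constant, so plain integrability of \<open>u\<close>
  suffices. The averaged source enters the equations this way.\<close>

lemma set_integrable_mult_S:
  fixes u :: "'a \<Rightarrow> real"
  assumes "set_integrable lebesgue \<Omega> u" "\<And>\<sigma> x. \<sigma> \<in> \<T> \<Longrightarrow> x \<in> \<sigma> \<Longrightarrow> \<eta> x = c \<sigma>"
  shows "set_integrable lebesgue \<Omega> (\<lambda>x. u x * \<eta> x)"
proof -
  have "set_integrable lebesgue \<sigma> (\<lambda>x. u x * \<eta> x)" if "\<sigma> \<in> \<T>" for \<sigma>
  proof -
    have "set_integrable lebesgue \<sigma> (\<lambda>x. u x * c \<sigma>)"
      using that assms(1) set_integrable_mesh_iff by auto
    then show ?thesis
      using assms(2)[OF that] by (simp cong: set_integrable_cong)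
  qed
  then show ?thesis by (simp add: set_integrable_mesh_iff)
qed

lemma L2_inner_S:
  assumes "set_integrable lebesgue \<Omega> u" "\<And>\<sigma> x. \<sigma> \<in> \<T> \<Longrightarrow> x \<in> \<sigma> \<Longrightarrow> \<eta> x = c \<sigma>"
  shows "L2_inner \<Omega> u \<eta> = (\<Sum>\<sigma>\<in>\<T>. c \<sigma> * (LINT x:\<sigma>|lebesgue. u x))"
proof -
  have "L2_inner \<Omega> u \<eta> = (\<Sum>\<sigma>\<in>\<T>. LINT x:\<sigma>|lebesgue. u x * \<eta> x)"
    unfolding L2_inner_def by (rule set_integral_mesh[OF set_integrable_mult_S[OF assms]])
  also have "\<dots> = (\<Sum>\<sigma>\<in>\<T>. LINT x:\<sigma>|lebesgue. u x * c \<sigma>)"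
    using assms(2) by (intro sum.cong refl set_lebesgue_integral_cong element_sets) auto
  finally show ?thesis by (simp add: mult.commute)
qed

lemma set_integral_element:
  assumes "\<sigma> \<in> \<T>" "\<And>x. x \<in> \<sigma> \<Longrightarrow> u x = (c::real)"
  shows "set_integrable lebesgue \<sigma> u" "(LINT x:\<sigma>|lebesgue. u x) = measure lebesgue \<sigma> * c"
proof -
  have *: "(\<lambda>x. indicator \<sigma> x *\<^sub>R u x) = (\<lambda>x. indicator \<sigma> x * c)"
    using assms(2) by (auto simp: indicator_def)
  show "set_integrable lebesgue \<sigma> u" "(LINT x:\<sigma>|lebesgue. u x) = measure lebesgue \<sigma> * c"
    unfolding set_integrable_def set_lebesgue_integral_def *
    using element_lmeasurable[OF assms(1)] by (auto simp: fmeasurable_def)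
qed

lemma set_integrable_S:
  assumes "\<And>\<sigma> x. \<sigma> \<in> \<T> \<Longrightarrow> x \<in> \<sigma> \<Longrightarrow> \<eta> x = (c \<sigma> :: real)"
  shows "set_integrable lebesgue \<Omega> \<eta>"
  unfolding set_integrable_mesh_iff using assms by (blast intro: set_integral_element(1))

text \<open>Only values inside elements are compared, so many pairs of functions share one
  coefficient family.\<close>

definition represents :: "('a set \<Rightarrow> real \<times> 'a \<times> real) \<Rightarrow> ('a \<Rightarrow> real) \<Rightarrow> ('a \<Rightarrow> 'a) \<Rightarrow> bool" where
  "represents g W Q \<longleftrightarrow> (\<forall>\<sigma>\<in>\<T>. \<forall>x\<in>\<sigma>. W x = fst (g \<sigma>) \<and> Q x = rt_val (g \<sigma>) x)"

definition common_facet_normal :: "'a set \<Rightarrow> 'a set \<Rightarrow> 'a \<Rightarrow> bool" where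
  "common_facet_normal \<sigma> \<sigma>' n \<longleftrightarrow>
    aff_dim (frontier \<sigma> \<inter> frontier \<sigma>') = int DIM('a) - 1 \<and>
    (\<forall>x\<in>frontier \<sigma> \<inter> frontier \<sigma>'. \<forall>y\<in>frontier \<sigma> \<inter> frontier \<sigma>'. n \<bullet> (x - y) = 0)"

text \<open>Coefficients are indexed by arbitrary sets; forcing zero outside \<open>\<T>\<close>
  makes the space finite-dimensional. The second condition is that of \<open>V_space\<close>, with
  one-sided limits replaced by values of the local polynomials.\<close>

definition discrete_states :: "('a set \<Rightarrow> real \<times> 'a \<times> real) set" where
  "discrete_states = {g. (\<forall>\<sigma>. \<sigma> \<notin> \<T> \<longrightarrow> g \<sigma> = 0) \<and>
     (\<forall>\<sigma>\<in>\<T>. \<forall>\<sigma>'\<in>\<T>. \<forall>n. common_facet_normal \<sigma> \<sigma>' n \<longrightarrow>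
        (\<forall>x\<in>frontier \<sigma> \<inter> frontier \<sigma>'. rt_val (g \<sigma>) x \<bullet> n = rt_val (g \<sigma>') x \<bullet> n))}"

lemma isCont_rt_val: "isCont (rt_val c) x"
  unfolding rt_val_def[abs_def]
  by (intro continuous_add continuous_scaleR continuous_const continuous_ident)

lemma represents_inner_value:
  assumes "represents g W Q" "\<sigma> \<in> \<T>" "x \<in> closure \<sigma>"
  shows "inner_value \<sigma> Q x = rt_val (g \<sigma>) x"
  using assms by (intro inner_value_eq element_open isCont_rt_val) (auto simp: represents_def)

lemma represents_divergence:
  assumes "represents g W Q" "\<sigma> \<in> \<T>" "x \<in> \<sigma>"
  shows "divergence Q x = rt_div (g \<sigma>)"
  unfolding rt_div_def using assms
  by (intro divergence_affine[OF element_open]) (auto simp: represents_def rt_val_def)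

text \<open>The local polynomials extend continuously to the facets, so their values there are the
  inner values of \<open>Q\<close>; the matching of normal components becomes a condition on the
  coefficients.\<close>

lemma represents_V_iff:
  assumes "represents g W Q"
  shows "Q \<in> V_space \<T> \<longleftrightarrow>
     (\<forall>\<sigma>\<in>\<T>. \<forall>\<sigma>'\<in>\<T>. \<forall>n. common_facet_normal \<sigma> \<sigma>' n \<longrightarrow>
        (\<forall>x\<in>frontier \<sigma> \<inter> frontier \<sigma>'. rt_val (g \<sigma>) x \<bullet> n = rt_val (g \<sigma>') x \<bullet> n))"
proof -
  have 1: "\<exists>a b. \<forall>x\<in>\<sigma>. Q x = a + b *\<^sub>R x" if "\<sigma> \<in> \<T>" for \<sigma>
    using assms that unfolding represents_def rt_val_def by blast
  have 2: "inner_value \<sigma> Q x = rt_val (g \<sigma>) x \<and> inner_value \<sigma>' Q x = rt_val (g \<sigma>') x"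
    if "\<sigma> \<in> \<T>" "\<sigma>' \<in> \<T>" "x \<in> frontier \<sigma> \<inter> frontier \<sigma>'" for \<sigma> \<sigma>' x
    using that by (simp add: represents_inner_value[OF assms] frontier_def)
  have 3: "(\<forall>x\<in>frontier \<sigma> \<inter> frontier \<sigma>'. inner_value \<sigma> Q x \<bullet> n = inner_value \<sigma>' Q x \<bullet> n)
      \<longleftrightarrow> (\<forall>x\<in>frontier \<sigma> \<inter> frontier \<sigma>'. rt_val (g \<sigma>) x \<bullet> n = rt_val (g \<sigma>') x \<bullet> n)"
    if "\<sigma> \<in> \<T>" "\<sigma>' \<in> \<T>" for \<sigma> \<sigma>' n
    by (rule ball_cong[OF refl]) (use 2[OF that] in simp)
  show ?thesis
    unfolding V_space_def common_facet_normal_def using 1 3 by simp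
qed

lemma discrete_state_exists:
  assumes "W \<in> S_space \<T>" "Q \<in> V_space \<T>"
  shows "\<exists>g\<in>discrete_states. represents g W Q"
proof -
  have "\<forall>\<sigma>\<in>\<T>. \<exists>c. \<forall>x\<in>\<sigma>. W x = fst c \<and> Q x = rt_val c x"
  proof
    fix \<sigma> assume \<sigma>: "\<sigma> \<in> \<T>"
    obtain w where "\<forall>x\<in>\<sigma>. W x = w"
      using assms(1) \<sigma> by (auto simp: S_space_def constant_on_def)
    moreover obtain a b where "\<forall>x\<in>\<sigma>. Q x = a + b *\<^sub>R x"
      using assms(2) \<sigma> unfolding V_space_def by blast
    ultimately show "\<exists>c. \<forall>x\<in>\<sigma>. W x = fst c \<and> Q x = rt_val c x"
      by (intro exI[of _ "(w, a, b)"]) (simp add: rt_val_def)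
  qed
  then obtain c where c: "\<forall>\<sigma>\<in>\<T>. \<forall>x\<in>\<sigma>. W x = fst (c \<sigma>) \<and> Q x = rt_val (c \<sigma>) x"
    by metis
  define g where "g \<sigma> = (if \<sigma> \<in> \<T> then c \<sigma> else 0)" for \<sigma>
  have g: "represents g W Q"
    using c by (auto simp: represents_def g_def)
  moreover have "g \<in> discrete_states"
    using represents_V_iff[OF g] assms(2) unfolding discrete_states_def by (simp add: g_def)
  ultimately show ?thesis by blast
qed

lemma represented_functions_exist:
  assumes "g \<in> discrete_states"
  obtains W Q where "represents g W Q" "W \<in> S_space \<T>" "Q \<in> V_space \<T>"
proof -
  \<comment> \<open>Off the elements \<open>THE\<close> is unspecified; this is harmless because
    both spaces, inner values included, look only inside elements.\<close>
  define s where "s x = (THE \<sigma>. \<sigma> \<in> \<T> \<and> x \<in> \<sigma>)" for x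
  have s: "s x = \<sigma>" if "\<sigma> \<in> \<T>" "x \<in> \<sigma>" for x \<sigma>
    unfolding s_def using that element_eq by (intro the_equality) auto
  have r: "represents g (\<lambda>x. fst (g (s x))) (\<lambda>x. rt_val (g (s x)) x)"
    using s by (simp add: represents_def)
  moreover have "(\<lambda>x. fst (g (s x))) \<in> S_space \<T>"
    using s by (auto simp: S_space_def constant_on_def)
  moreover have "(\<lambda>x. rt_val (g (s x)) x) \<in> V_space \<T>"
    using represents_V_iff[OF r] assms by (simp add: discrete_states_def)
  ultimately show ?thesis by (rule that)
qed

lemma S_space_E:
  assumes "W \<in> S_space \<T>"
  obtains c where "\<And>\<sigma> x. \<sigma> \<in> \<T> \<Longrightarrow> x \<in> \<sigma> \<Longrightarrow> W x = c \<sigma>"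
proof -
  have "\<forall>\<sigma>\<in>\<T>. \<exists>c. \<forall>x\<in>\<sigma>. W x = c"
    using assms by (auto simp: S_space_def constant_on_def)
  then show ?thesis using that by metis
qed

lemma elem_mean_eq:
  assumes "\<sigma> \<in> \<T>" "x \<in> \<sigma>"
  shows "elem_mean \<T> v x = (LINT y:\<sigma>|lebesgue. v y) / measure lebesgue \<sigma>"
proof -
  have "elem_mean \<T> v x = (\<Sum>\<sigma>'\<in>\<T>. if \<sigma>' = \<sigma> then (LINT y:\<sigma>|lebesgue. v y) / measure lebesgue \<sigma> else 0)"
    unfolding elem_mean_def using assms element_eq by (intro sum.cong refl) (auto simp: indicator_def)
  then show ?thesis using assms finite_elements by simp
qed

lemma elem_mean_S: "elem_mean \<T> v \<in> S_space \<T>"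
  unfolding S_space_def constant_on_def by (intro CollectI ballI exI) (rule elem_mean_eq)

text \<open>On one element \<open>w0h\<close> is a mean and \<open>k1h\<close> comes from the
  constant gradient of an affine function, so the operator acts through a scalar ramp. Its
  continuity serves solvability, the bound by \<open>k0\<close> serves coercivity.\<close>

lemma M_op_coefficient:
  assumes "\<epsilon> > 0"
  shows "\<exists>\<mu>. \<forall>\<sigma>\<in>\<T>. continuous_on UNIV (\<mu> \<sigma>) \<and> (\<forall>s. \<mu> \<sigma> s \<ge> k0) \<and>
    (\<forall>x\<in>\<sigma>. \<forall>W. M_op \<Omega> \<T> k0 \<epsilon> w0 W x = \<mu> \<sigma> (W x))"
proof -
  have "\<exists>\<mu>. continuous_on UNIV \<mu> \<and> (\<forall>s. \<mu> s \<ge> k0) \<and>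
      (\<forall>x\<in>\<sigma>. \<forall>W. M_op \<Omega> \<T> k0 \<epsilon> w0 W x = \<mu> (W x))" if \<sigma>: "\<sigma> \<in> \<T>" for \<sigma>
  proof -
    define c where "c = (LINT y:\<sigma>|lebesgue. nodal_interp \<Omega> \<T> w0 y) / measure lebesgue \<sigma>"
    have c: "w0h \<Omega> \<T> w0 x = c" if "x \<in> \<sigma>" for x
      unfolding w0h_def c_def by (rule elem_mean_eq[OF \<sigma> that])
    have "\<exists>a b. \<forall>x\<in>\<sigma>. nodal_interp \<Omega> \<T> w0 x = a + b \<bullet> x"
      using nodal_interp(1)[of w0] \<sigma> by (simp add: U_space_def)
    then obtain a b where ab: "\<forall>x\<in>\<sigma>. nodal_interp \<Omega> \<T> w0 x = a + b \<bullet> x"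
      by (elim exE)
    define k1 where "k1 = max k0 (norm b)"
    have k1: "k1h \<Omega> \<T> k0 w0 x = k1" if "x \<in> \<sigma>" for x
    proof -
      have "grad (nodal_interp \<Omega> \<T> w0) x = b"
        by (rule grad_affine[OF element_open[OF \<sigma>] that, of _ a]) (use ab in blast)
      then show ?thesis by (simp add: k1h_def k1_def)
    qed
    define \<mu> where "\<mu> = (\<lambda>s. k1 + (k0 - k1) * max 0 (min 1 ((s - c) / \<epsilon>)))"
    have "continuous_on UNIV \<mu>"
      unfolding \<mu>_def using assms by (intro continuous_intros) auto
    moreover have "k0 \<le> \<mu> s" for s
    proof -
      have "(k1 - k0) * max 0 (min 1 ((s - c) / \<epsilon>)) \<le> (k1 - k0) * 1"
        by (intro mult_left_mono) (auto simp: k1_def)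
      then show ?thesis by (simp add: \<mu>_def algebra_simps)
    qed
    moreover have "M_op \<Omega> \<T> k0 \<epsilon> w0 W x = \<mu> (W x)" if "x \<in> \<sigma>" for x W
      unfolding M_op_def c[OF that] k1[OF that] \<mu>_def by (rule ramp_eq[OF assms])
    ultimately show ?thesis by blast
  qed
  then show ?thesis by metis
qed

text \<open>For r > 1 the nonlinear flux of the local polynomial is continuous even at a vertex
  where it vanishes, so its limit from within is its value.\<close>

lemma quad_inner_flux:
  assumes r: "1 < r" and g: "represents g W Q" and h: "represents h \<eta> v"
    and M: "\<And>\<sigma> x. \<sigma> \<in> \<T> \<Longrightarrow> x \<in> \<sigma> \<Longrightarrow> M x = m \<sigma>"
  shows "quad_inner \<T> (\<lambda>x. M x *\<^sub>R (norm (Q x) powr (r - 2) *\<^sub>R Q x)) v =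
    (\<Sum>\<sigma>\<in>\<T>. measure lebesgue \<sigma> / (real DIM('a) + 1) * m \<sigma> *
       (\<Sum>x\<in>vertices \<sigma>. (norm (rt_val (g \<sigma>) x) powr (r - 2) *\<^sub>R rt_val (g \<sigma>) x) \<bullet> rt_val (h \<sigma>) x))"
proof -
  have "inner_value \<sigma> (\<lambda>x. M x *\<^sub>R (norm (Q x) powr (r - 2) *\<^sub>R Q x)) x
      = m \<sigma> *\<^sub>R (norm (rt_val (g \<sigma>) x) powr (r - 2) *\<^sub>R rt_val (g \<sigma>) x)"
    if "\<sigma> \<in> \<T>" "x \<in> vertices \<sigma>" for \<sigma> x
  proof (rule inner_value_eq[OF element_open[OF that(1)]])
    show "x \<in> closure \<sigma>" using that vertices_subset by blast
    show "isCont (\<lambda>y. m \<sigma> *\<^sub>R (norm (rt_val (g \<sigma>) y) powr (r - 2) *\<^sub>R rt_val (g \<sigma>) y)) x"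
    proof -
      have "continuous_on UNIV (rt_val (g \<sigma>))"
        by (simp add: continuous_on_eq_continuous_at isCont_rt_val)
      then have "continuous_on UNIV (\<lambda>y. norm (rt_val (g \<sigma>) y) powr (r - 2) *\<^sub>R rt_val (g \<sigma>) y)"
        by (rule continuous_power_field[OF r])
      then show ?thesis
        by (intro continuous_scaleR[OF continuous_const]) (simp add: continuous_on_eq_continuous_at)
    qed
  qed (use g M that in \<open>auto simp: represents_def\<close>)
  moreover have "inner_value \<sigma> v x = rt_val (h \<sigma>) x" if "\<sigma> \<in> \<T>" "x \<in> vertices \<sigma>" for \<sigma> x
    using represents_inner_value[OF h that(1)] vertices_subset that by blast
  ultimately show ?thesis
    unfolding quad_inner_def by (intro sum.cong refl) (simp add: sum_distrib_left mult.assoc)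
qed

end

text \<open>The preimage of a ball under an affine map. It carries bounds from the vertices to the
  whole element: with \<open>B = 0\<close> for unisolvence, with the largest vertex value for the
  pointwise estimate of the flux.\<close>

lemma convex_norm_rt_val_le: "convex {x. norm (rt_val c x) \<le> B}"
proof (rule convexI, clarify)
  fix x y and u v :: real
  assume xy: "norm (rt_val c x) \<le> B" "norm (rt_val c y) \<le> B" and uv: "0 \<le> u" "0 \<le> v" "u + v = 1"
  then have "rt_val c (u *\<^sub>R x + v *\<^sub>R y)
      = (u + v) *\<^sub>R fst (snd c) + snd (snd c) *\<^sub>R (u *\<^sub>R x + v *\<^sub>R y)"
    by (simp add: rt_val_def)
  also have "\<dots> = u *\<^sub>R rt_val c x + v *\<^sub>R rt_val c y"
    by (simp add: rt_val_def algebra_simps)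
  also have "norm \<dots> \<le> u * norm (rt_val c x) + v * norm (rt_val c y)"
    using uv norm_triangle_ineq[of "u *\<^sub>R rt_val c x" "v *\<^sub>R rt_val c y"] by simp
  also have "\<dots> \<le> u * B + v * B"
    using xy uv by (intro add_mono mult_left_mono) auto
  finally show "norm (rt_val c (u *\<^sub>R x + v *\<^sub>R y)) \<le> B"
    using uv by (simp flip: distrib_right)
qed

section \<open>Unisolvence and existence for one time step\<close>

context mesh
begin

text \<open>A field vanishing at the vertices vanishes on their hull; comparing two points of the
  open element gives zero slope, then zero constant. So vertex quadrature sees every nonzero field,
  as \<open>inj\<close> in \<open>discrete_step_solvable\<close> demands.\<close>

lemma rt_val_zero_on_vertices:
  assumes \<sigma>: "\<sigma> \<in> \<T>" and zero: "\<And>x. x \<in> vertices \<sigma> \<Longrightarrow> rt_val c x = 0"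
  shows "snd c = 0"
proof -
  have "convex {x. rt_val c x = 0}"
    using convex_norm_rt_val_le[of c 0] by simp
  then have "closure \<sigma> \<subseteq> {x. rt_val c x = 0}"
    unfolding vertices_element(1)[OF \<sigma>] using zero by (intro hull_minimal) auto
  then have zero: "fst (snd c) + snd (snd c) *\<^sub>R x = 0" if "x \<in> \<sigma>" for x
    using that closure_subset[of \<sigma>] by (auto simp: rt_val_def)
  obtain x where x: "x \<in> \<sigma>" using element_nonempty[OF \<sigma>] by blast
  obtain d where d: "d > 0" "ball x d \<subseteq> \<sigma>"
    using element_open[OF \<sigma>] x openE by blast
  obtain i :: 'a where i: "i \<in> Basis" using nonempty_Basis by blast
  have "x + (d/2) *\<^sub>R i \<in> \<sigma>"
    using d i by (intro subsetD[OF d(2)]) (simp add: dist_norm)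
  then have "snd (snd c) *\<^sub>R ((d/2) *\<^sub>R i) = 0"
    using zero[OF x] zero[of "x + (d/2) *\<^sub>R i"]
    by (metis add_left_cancel add.right_neutral scaleR_add_right add.assoc)
  then have "snd (snd c) = 0" using d i by auto
  with zero[OF x] show ?thesis by (simp add: prod_eq_iff)
qed

lemma Q_step_exists:
  assumes pos: "k0 > 0" "\<epsilon> > 0" "tstep t n > 0" and r: "1 < r" "r < 2"
    and Wp: "Wp \<in> S_space \<T>" and f: "set_integrable lebesgue \<Omega> (time_mean t f n)"
  shows "\<exists>W Q. Q_step \<Omega> \<T> k0 \<epsilon> w0 f t r n Wp W Q"
proof -
  obtain \<mu> where "\<forall>\<sigma>\<in>\<T>. continuous_on UNIV (\<mu> \<sigma>) \<and> (\<forall>s. \<mu> \<sigma> s \<ge> k0) \<and>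
      (\<forall>x\<in>\<sigma>. \<forall>W. M_op \<Omega> \<T> k0 \<epsilon> w0 W x = \<mu> \<sigma> (W x))"
    using M_op_coefficient[OF pos(2), of k0 w0] by (elim exE)
  then have \<mu>: "\<And>\<sigma>. \<sigma> \<in> \<T> \<Longrightarrow> continuous_on UNIV (\<mu> \<sigma>)" "\<And>\<sigma> s. \<sigma> \<in> \<T> \<Longrightarrow> \<mu> \<sigma> s \<ge> k0"
    "\<And>\<sigma> x W. \<sigma> \<in> \<T> \<Longrightarrow> x \<in> \<sigma> \<Longrightarrow> M_op \<Omega> \<T> k0 \<epsilon> w0 W x = \<mu> \<sigma> (W x)"
    by blast+
  obtain p where p: "\<And>\<sigma> x. \<sigma> \<in> \<T> \<Longrightarrow> x \<in> \<sigma> \<Longrightarrow> Wp x = p \<sigma>"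
    using S_space_E[OF Wp] by metis
  define \<tau> where "\<tau> = tstep t n"
  define F where "F \<sigma> = (LINT x:\<sigma>|lebesgue. time_mean t f n x)" for \<sigma>
  let ?\<alpha> = "measure lebesgue :: 'a set \<Rightarrow> real"
  let ?\<beta> = "\<lambda>\<sigma>::'a set. measure lebesgue \<sigma> / (real DIM('a) + 1)"
  \<comment> \<open>The data after multiplication by the step size: the previous value loses its
    divisor, the source gains the factor \<open>\<tau>\<close>.\<close>
  let ?b = "\<lambda>\<sigma>. measure lebesgue \<sigma> * p \<sigma> + \<tau> * F \<sigma>"
  let ?B = "step_form \<T> vertices ?\<alpha> ?\<beta> \<mu> ?b \<tau> r"
  have "\<exists>g\<in>discrete_states. \<forall>h\<in>discrete_states. ?B g h = 0"
  proof (rule discrete_step_solvable[where K = \<T> and V = vertices and \<alpha> = ?\<alpha> and \<beta> = ?\<beta>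
        and \<mu> = \<mu> and b = ?b and \<tau> = \<tau> and r = r and X = discrete_states and ?k0.0 = k0])
    show "c = 0" if "\<sigma> \<in> \<T>" "fst c = 0" "\<And>x. x \<in> vertices \<sigma> \<Longrightarrow> rt_val c x = 0" for \<sigma> c
      using rt_val_zero_on_vertices[OF that(1,3)] that(2) by (simp add: prod_eq_iff)
    show "g \<sigma> = 0" if "g \<in> discrete_states" "\<sigma> \<notin> \<T>" for g \<sigma>
      using that by (simp add: discrete_states_def)
    show "(\<lambda>\<sigma>. 0) \<in> discrete_states"
      by (simp add: discrete_states_def rt_val_def)
    show "(\<lambda>\<sigma>. g \<sigma> + h \<sigma>) \<in> discrete_states" if "g \<in> discrete_states" "h \<in> discrete_states" for g h
    proof -
      have "rt_val (g \<sigma> + h \<sigma>) x = rt_val (g \<sigma>) x + rt_val (h \<sigma>) x" for \<sigma> x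
        by (simp add: rt_val_def algebra_simps)
      then show ?thesis using that by (simp add: discrete_states_def inner_add_left)
    qed
    show "(\<lambda>\<sigma>. c *\<^sub>R g \<sigma>) \<in> discrete_states" if "g \<in> discrete_states" for c g
    proof -
      have "rt_val (c *\<^sub>R g \<sigma>) x = c *\<^sub>R rt_val (g \<sigma>) x" for \<sigma> x
        by (simp add: rt_val_def algebra_simps)
      then show ?thesis using that by (simp add: discrete_states_def)
    qed
    show "finite (vertices \<sigma>)" if "\<sigma> \<in> \<T>" for \<sigma> using vertices_element(3)[OF that] .
    show "?\<alpha> \<sigma> > 0" "?\<beta> \<sigma> > 0" if "\<sigma> \<in> \<T>" for \<sigma> using measure_element_pos[OF that] by auto
    show "continuous_on UNIV (\<mu> \<sigma>)" "k0 \<le> \<mu> \<sigma> s" if "\<sigma> \<in> \<T>" for \<sigma> s by (rule \<mu>[OF that])+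
    show "\<tau> > 0" using pos by (simp add: \<tau>_def)
  qed (fact finite_elements pos r)+
  then obtain g where g: "g \<in> discrete_states" "\<And>h. h \<in> discrete_states \<Longrightarrow> ?B g h = 0"
    by blast
  obtain W Q where WQ: "represents g W Q" "W \<in> S_space \<T>" "Q \<in> V_space \<T>"
    using represented_functions_exist[OF g(1)] by blast
  have Wg: "W x = fst (g \<sigma>)" if "\<sigma> \<in> \<T>" "x \<in> \<sigma>" for \<sigma> x
    using WQ(1) that by (auto simp: represents_def)
  have divQ: "divergence Q x = rt_div (g \<sigma>)" if "\<sigma> \<in> \<T>" "x \<in> \<sigma>" for \<sigma> x
    by (rule represents_divergence[OF WQ(1) that])
  have "L2_inner \<Omega> (\<lambda>x. (W x - Wp x) / tstep t n) \<eta> + L2_inner \<Omega> (divergence Q) \<eta>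
          = L2_inner \<Omega> (time_mean t f n) \<eta>" if \<eta>: "\<eta> \<in> S_space \<T>" for \<eta>
  proof -
    \<comment> \<open>The zero flux as second test component isolates the balance equation from the
      combined form.\<close>
    have "(\<lambda>x. 0) \<in> V_space \<T>"
      using represents_V_iff[of "\<lambda>_. 0" "\<lambda>_. 0" "\<lambda>_. 0"] by (simp add: represents_def rt_val_def)
    then obtain h where h: "h \<in> discrete_states" "represents h \<eta> (\<lambda>x. 0)"
      using discrete_state_exists[OF \<eta>] by blast
    have \<eta>h: "\<eta> x = fst (h \<sigma>)" if "\<sigma> \<in> \<T>" "x \<in> \<sigma>" for \<sigma> x
      using h(2) that by (auto simp: represents_def)
    have h0: "rt_val (h \<sigma>) x = 0" "rt_div (h \<sigma>) = 0" if \<sigma>: "\<sigma> \<in> \<T>" and x: "x \<in> closure \<sigma>" for \<sigma> x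
    proof -
      show "rt_val (h \<sigma>) x = 0"
        using represents_inner_value[OF h(2) \<sigma> x] inner_value_eq[OF element_open[OF \<sigma>] x, of "\<lambda>_. 0" "\<lambda>_. 0 :: 'a"] by simp
      obtain y where "y \<in> \<sigma>" using element_nonempty[OF \<sigma>] by blast
      then show "rt_div (h \<sigma>) = 0"
        using represents_divergence[OF h(2) \<sigma>, of y]
          divergence_affine[OF element_open[OF \<sigma>], of y "\<lambda>_. 0" 0 0] by simp
    qed
    have 1: "L2_inner \<Omega> (\<lambda>x. (W x - Wp x) / tstep t n) \<eta>
        = (\<Sum>\<sigma>\<in>\<T>. fst (h \<sigma>) * (measure lebesgue \<sigma> * ((fst (g \<sigma>) - p \<sigma>) / \<tau>)))"
    proof (subst L2_inner_S[OF _ \<eta>h])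
      show "set_integrable lebesgue \<Omega> (\<lambda>x. (W x - Wp x) / tstep t n)"
        by (rule set_integrable_S[where c = "\<lambda>\<sigma>. (fst (g \<sigma>) - p \<sigma>) / \<tau>"]) (simp add: Wg p \<tau>_def)
      show "(\<Sum>\<sigma>\<in>\<T>. fst (h \<sigma>) * (LINT x:\<sigma>|lebesgue. (W x - Wp x) / tstep t n))
        = (\<Sum>\<sigma>\<in>\<T>. fst (h \<sigma>) * (measure lebesgue \<sigma> * ((fst (g \<sigma>) - p \<sigma>) / \<tau>)))"
        by (intro sum.cong refl arg_cong2[where f = "(*)"] set_integral_element) (auto simp: Wg p \<tau>_def)
    qed auto
    have 2: "L2_inner \<Omega> (divergence Q) \<eta> = (\<Sum>\<sigma>\<in>\<T>. fst (h \<sigma>) * (measure lebesgue \<sigma> * rt_div (g \<sigma>)))"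
    proof (subst L2_inner_S[OF _ \<eta>h])
      show "set_integrable lebesgue \<Omega> (divergence Q)"
        by (rule set_integrable_S[OF divQ])
      show "(\<Sum>\<sigma>\<in>\<T>. fst (h \<sigma>) * (LINT x:\<sigma>|lebesgue. divergence Q x))
        = (\<Sum>\<sigma>\<in>\<T>. fst (h \<sigma>) * (measure lebesgue \<sigma> * rt_div (g \<sigma>)))"
        by (intro sum.cong refl arg_cong2[where f = "(*)"] set_integral_element) (auto simp: divQ)
    qed auto
    have 3: "L2_inner \<Omega> (time_mean t f n) \<eta> = (\<Sum>\<sigma>\<in>\<T>. fst (h \<sigma>) * F \<sigma>)"
      unfolding F_def by (rule L2_inner_S[OF f \<eta>h])
    have "?B g h = (\<Sum>\<sigma>\<in>\<T>. \<tau> * (fst (h \<sigma>) * (measure lebesgue \<sigma> * ((fst (g \<sigma>) - p \<sigma>) / \<tau>))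
            + fst (h \<sigma>) * (measure lebesgue \<sigma> * rt_div (g \<sigma>)) - fst (h \<sigma>) * F \<sigma>))"
      unfolding step_form_def
    proof (intro sum.cong refl)
      fix \<sigma> assume \<sigma>: "\<sigma> \<in> \<T>"
      obtain y where y: "y \<in> \<sigma>" using element_nonempty[OF \<sigma>] by blast
      have "(\<Sum>x\<in>vertices \<sigma>. (norm (rt_val (g \<sigma>) x) powr (r - 2) *\<^sub>R rt_val (g \<sigma>) x) \<bullet> rt_val (h \<sigma>) x) = 0"
        using h0(1)[OF \<sigma>] vertices_subset[OF \<sigma>] by (intro sum.neutral) auto
      moreover have "rt_div (h \<sigma>) = 0" using h0(2)[OF \<sigma>, of y] y closure_subset by blast
      ultimately show "?\<alpha> \<sigma> * fst (g \<sigma>) * fst (h \<sigma>) + \<tau> * ?\<alpha> \<sigma> * rt_div (g \<sigma>) * fst (h \<sigma>) - ?b \<sigma> * fst (h \<sigma>)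
            + \<tau> * ?\<beta> \<sigma> * \<mu> \<sigma> (fst (g \<sigma>)) *
          (\<Sum>x\<in>vertices \<sigma>. (norm (rt_val (g \<sigma>) x) powr (r - 2) *\<^sub>R rt_val (g \<sigma>) x) \<bullet> rt_val (h \<sigma>) x)
           - \<tau> * ?\<alpha> \<sigma> * fst (g \<sigma>) * rt_div (h \<sigma>)
        = \<tau> * (fst (h \<sigma>) * (measure lebesgue \<sigma> * ((fst (g \<sigma>) - p \<sigma>) / \<tau>))
            + fst (h \<sigma>) * (measure lebesgue \<sigma> * rt_div (g \<sigma>)) - fst (h \<sigma>) * F \<sigma>)"
        using pos(3) by (simp add: \<tau>_def[symmetric] field_simps)
    qed
    also have "\<dots> = \<tau> * (L2_inner \<Omega> (\<lambda>x. (W x - Wp x) / tstep t n) \<eta> + L2_inner \<Omega> (divergence Q) \<eta>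
          - L2_inner \<Omega> (time_mean t f n) \<eta>)"
      unfolding 1 2 3 by (simp add: sum_distrib_left sum.distrib sum_subtractf distrib_left right_diff_distrib)
    finally show ?thesis
      using g(2)[OF h(1)] pos(3) by (simp add: \<tau>_def)
  qed
  moreover have "quad_inner \<T> (\<lambda>x. M_op \<Omega> \<T> k0 \<epsilon> w0 W x *\<^sub>R (norm (Q x) powr (r - 2) *\<^sub>R Q x)) v
          - L2_inner \<Omega> W (divergence v) = 0" if v: "v \<in> V_space \<T>" for v
  proof -
    \<comment> \<open>Symmetrically, a zero first test component isolates the flux equation.\<close>
    have "(\<lambda>x. 0) \<in> S_space \<T>" by (simp add: S_space_def constant_on_def)
    then obtain h where h: "h \<in> discrete_states" "represents h (\<lambda>x. 0) v"
      using discrete_state_exists[OF _ v] by blast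
    have h0: "fst (h \<sigma>) = 0" if "\<sigma> \<in> \<T>" for \<sigma>
      using h(2) element_nonempty[OF that] that unfolding represents_def by fastforce
    have 1: "quad_inner \<T> (\<lambda>x. M_op \<Omega> \<T> k0 \<epsilon> w0 W x *\<^sub>R (norm (Q x) powr (r - 2) *\<^sub>R Q x)) v =
       (\<Sum>\<sigma>\<in>\<T>. measure lebesgue \<sigma> / (real DIM('a) + 1) * \<mu> \<sigma> (fst (g \<sigma>)) *
       (\<Sum>x\<in>vertices \<sigma>. (norm (rt_val (g \<sigma>) x) powr (r - 2) *\<^sub>R rt_val (g \<sigma>) x) \<bullet> rt_val (h \<sigma>) x))"
      by (rule quad_inner_flux[OF r(1) WQ(1) h(2)]) (simp add: \<mu>(3) Wg)
    have 2: "L2_inner \<Omega> W (divergence v) = (\<Sum>\<sigma>\<in>\<T>. rt_div (h \<sigma>) * (measure lebesgue \<sigma> * fst (g \<sigma>)))"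
    proof (subst L2_inner_S[OF set_integrable_S[OF Wg] represents_divergence[OF h(2)]])
      show "(\<Sum>\<sigma>\<in>\<T>. rt_div (h \<sigma>) * (LINT x:\<sigma>|lebesgue. W x))
        = (\<Sum>\<sigma>\<in>\<T>. rt_div (h \<sigma>) * (measure lebesgue \<sigma> * fst (g \<sigma>)))"
        by (intro sum.cong refl arg_cong2[where f = "(*)"] set_integral_element) (auto simp: Wg)
    qed auto
    have "0 = ?B g h" using g(2)[OF h(1)] by simp
    also have "\<dots> = \<tau> * (quad_inner \<T> (\<lambda>x. M_op \<Omega> \<T> k0 \<epsilon> w0 W x *\<^sub>R (norm (Q x) powr (r - 2) *\<^sub>R Q x)) v
          - L2_inner \<Omega> W (divergence v))"
      unfolding 1 2 step_form_def sum_subtractf[symmetric] sum_distrib_left[of \<tau>]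
      by (intro sum.cong refl) (simp add: h0 right_diff_distrib ac_simps)
    finally show ?thesis using pos(3) by (simp add: \<tau>_def)
  qed
  ultimately have "Q_step \<Omega> \<T> k0 \<epsilon> w0 f t r n Wp W Q"
    unfolding Q_step_def using WQ(2,3) by blast
  then show ?thesis by blast
qed

end

section \<open>Time averages of the source\<close>

text \<open>Jensen's inequality for the average over \<open>A\<close>, for almost every
  \<open>x\<close>, followed by Fubini. On a finite measure space
  \<open>\<bar>y\<bar> \<le> 1 + y\<^sup>2\<close> turns square integrability into the integrability
  that Fubini requires.\<close>

lemma partial_mean_square:
  fixes g :: "'s \<Rightarrow> 'x \<Rightarrow> real"
  assumes fin: "finite_measure M1" "finite_measure M2"
    and meas: "(\<lambda>(s, x). g s x) \<in> borel_measurable (M1 \<Otimes>\<^sub>M M2)"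
    and sq: "integrable (M1 \<Otimes>\<^sub>M M2) (\<lambda>(s, x). (g s x)\<^sup>2)"
    and A: "A \<in> sets M1" and m: "m = measure M1 A" "m > 0"
  defines "h \<equiv> \<lambda>x. (\<integral>s. indicator A s * g s x \<partial>M1) / m"
  shows "integrable M2 h" "integrable M2 (\<lambda>x. (h x)\<^sup>2)"
    "integrable (M1 \<Otimes>\<^sub>M M2) (\<lambda>(s, x). indicator A s * (g s x)\<^sup>2)"
    "m * (\<integral>x. (h x)\<^sup>2 \<partial>M2) \<le> (\<integral>(s, x). indicator A s * (g s x)\<^sup>2 \<partial>(M1 \<Otimes>\<^sub>M M2))"
proof -
  interpret M1: finite_measure M1 by fact
  interpret M2: finite_measure M2 by fact
  interpret P: pair_sigma_finite M1 M2 ..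
  interpret PF: finite_measure "M1 \<Otimes>\<^sub>M M2" by (rule finite_measure_pair_measure[OF fin(2,1)])
  let ?P = "M1 \<Otimes>\<^sub>M M2"
  have indm: "(\<lambda>(s, x). indicator A s :: real) \<in> borel_measurable ?P"
    using A by (simp add: case_prod_unfold)
  have dom: "integrable ?P (\<lambda>(s, x). 1 + (g s x)\<^sup>2)"
    using sq by (simp add: case_prod_unfold)
  have g_int: "integrable ?P (\<lambda>(s, x). indicator A s * g s x)"
  proof (rule Bochner_Integration.integrable_bound[OF dom])
    show "(\<lambda>(s, x). indicator A s * g s x) \<in> borel_measurable ?P"
      using meas indm by (simp add: case_prod_unfold)
    have "\<bar>y\<bar> \<le> 1 + y\<^sup>2" for y :: real
    proof -
      have "0 \<le> (\<bar>y\<bar> - 1)\<^sup>2" by simp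
      then have "2 * \<bar>y\<bar> \<le> 1 + y\<^sup>2" by (simp add: power2_diff)
      then show ?thesis by linarith
    qed
    then show "AE p in ?P. norm (case p of (s, x) \<Rightarrow> indicator A s * g s x) \<le> norm (case p of (s, x) \<Rightarrow> 1 + (g s x)\<^sup>2)"
      by (intro AE_I2) (auto simp: indicator_def abs_of_nonneg add_nonneg_nonneg)
  qed
  show sq_int: "integrable ?P (\<lambda>(s, x). indicator A s * (g s x)\<^sup>2)"
  proof (rule Bochner_Integration.integrable_bound[OF sq])
    show "(\<lambda>(s, x). indicator A s * (g s x)\<^sup>2) \<in> borel_measurable ?P"
      using meas indm by (simp add: case_prod_unfold)
  qed (auto simp: indicator_def)
  show h_int: "integrable M2 h"
    unfolding h_def using P.integrable_snd[OF g_int] by simp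
  define q where "q x = (\<integral>s. indicator A s * (g s x)\<^sup>2 \<partial>M1)" for x
  have q_int: "integrable M2 q"
    unfolding q_def by (rule P.integrable_snd[OF sq_int])
  have le: "AE x in M2. m * (h x)\<^sup>2 \<le> q x"
    using P.AE_integrable_snd[OF g_int] P.AE_integrable_snd[OF sq_int]
  proof eventually_elim
    case (elim x)
    let ?c = "h x"
    have iA: "integrable M1 (\<lambda>s. indicator A s :: real)"
      by (intro integrable_real_indicator A) (simp add: M1.emeasure_finite less_top[symmetric])
    \<comment> \<open>With \<open>c\<close> the average,
      \<open>2 * c * g - c\<^sup>2 \<le> g\<^sup>2\<close> is integrated over \<open>A\<close>; as
      \<open>g\<close> integrates to \<open>m * c\<close>, the left side becomes
      \<open>m * c\<^sup>2\<close>.\<close>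
    have "2 * ?c * (m * ?c) - ?c\<^sup>2 * m
        = (\<integral>s. 2 * ?c * (indicator A s * g s x) - ?c\<^sup>2 * indicator A s \<partial>M1)"
      using elim(1) iA A m by (simp add: h_def)
    also have "\<dots> \<le> q x"
      unfolding q_def
    proof (rule integral_mono)
      show "2 * ?c * (indicator A s * g s x) - ?c\<^sup>2 * indicator A s \<le> indicator A s * (g s x)\<^sup>2" for s
        using zero_le_power2[of "g s x - ?c"] by (auto simp: indicator_def power2_diff algebra_simps)
    qed (use elim iA in auto)
    finally show ?case by (simp add: power2_eq_square)
  qed
  show h2_int: "integrable M2 (\<lambda>x. (h x)\<^sup>2)"
  proof (rule Bochner_Integration.integrable_bound)
    show "integrable M2 (\<lambda>x. q x / m)" using q_int by simp
    show "AE x in M2. norm ((h x)\<^sup>2) \<le> norm (q x / m)"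
      using le
    proof eventually_elim
      case (elim x)
      then have "(h x)\<^sup>2 \<le> q x / m" using m(2) by (simp add: field_simps)
      also have "\<dots> \<le> norm (q x / m)" unfolding real_norm_def by (rule abs_ge_self)
      finally show ?case by simp
    qed
  qed (use h_int in measurable)
  have "m * (\<integral>x. (h x)\<^sup>2 \<partial>M2) = (\<integral>x. m * (h x)\<^sup>2 \<partial>M2)" by simp
  also have "\<dots> \<le> (\<integral>x. q x \<partial>M2)"
    using h2_int q_int le by (intro integral_mono_AE) auto
  also have "\<dots> = (\<integral>(s, x). indicator A s * (g s x)\<^sup>2 \<partial>?P)"
    unfolding q_def by (rule P.integral_snd[OF sq_int])
  finally show "m * (\<integral>x. (h x)\<^sup>2 \<partial>M2) \<le> (\<integral>(s, x). indicator A s * (g s x)\<^sup>2 \<partial>?P)" .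
qed

lemma time_partition_mono:
  assumes t: "time_partition T N t" and "m \<le> n" "n \<le> N"
  shows "t m \<le> t n"
  using assms(2,3)
proof (induction n rule: dec_induct)
  case (step n)
  then have "t (Suc n - 1) < t (Suc n)"
    using t unfolding time_partition_def by (metis Suc_leI atLeastAtMost_iff le_add1 plus_1_eq_Suc zero_less_Suc Suc_le_eq)
  with step show ?case by simp
qed simp

lemma time_partition_step:
  assumes t: "time_partition T N t" and n: "n \<in> {1..N}"
  shows "0 \<le> t (n - 1)" "t (n - 1) < t n" "t n \<le> T" "tstep t n > 0"
  using time_partition_mono[OF t, of 0 "n - 1"] time_partition_mono[OF t, of n N] t n
  by (auto simp: time_partition_def tstep_def)

lemma sum_tstep:
  assumes t: "time_partition T N t" and "n \<le> N"
  shows "(\<Sum>i=1..n. tstep t i) = t n"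
  using assms(2)
proof (induction n)
  case 0
  then show ?case using t by (simp add: time_partition_def)
qed (simp add: tstep_def)

text \<open>Each average falls under \<open>partial_mean_square\<close> with its own time interval.
  The intervals are disjoint, so their indicators add up to at most 1 and the total stays below the
  squared norm of \<open>f\<close>.\<close>

lemma
  fixes f :: "real \<Rightarrow> 'a::euclidean_space \<Rightarrow> real"
  assumes \<Omega>: "\<Omega> \<in> lmeasurable" and f: "f \<in> L2_L2 T \<Omega>" and t: "time_partition T N t"
  shows time_mean_integrable: "n \<in> {1..N} \<Longrightarrow> set_integrable lebesgue \<Omega> (time_mean t f n)"
    and time_mean_square_integrable: "n \<in> {1..N} \<Longrightarrow> set_integrable lebesgue \<Omega> (\<lambda>x. (time_mean t f n x)\<^sup>2)"
    and time_mean_square_sum: "(\<Sum>n=1..N. tstep t n * (LINT x:\<Omega>|lebesgue. (time_mean t f n x)\<^sup>2))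
      \<le> (\<integral>(s, x). (f s x)\<^sup>2 \<partial>(lebesgue_on {0<..<T} \<Otimes>\<^sub>M lebesgue_on \<Omega>))"
proof -
  let ?M1 = "lebesgue_on {0<..<T}" and ?M2 = "lebesgue_on \<Omega>"
  let ?I = "\<lambda>n. {t (n - 1)<..<t n}"
  have fin: "finite_measure ?M1" "finite_measure ?M2"
    using \<Omega> by (auto intro: finite_measure_lebesgue_on simp: lmeasurable_open)
  have \<Omega>_sets: "\<Omega> \<inter> space lebesgue \<in> sets lebesgue"
    using \<Omega> by (simp add: fmeasurableD)
  have f': "(\<lambda>(s, x). f s x) \<in> borel_measurable (?M1 \<Otimes>\<^sub>M ?M2)"
    "integrable (?M1 \<Otimes>\<^sub>M ?M2) (\<lambda>(s, x). (f s x)\<^sup>2)"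
    using f by (auto simp: L2_L2_def)
  have sub: "?I n \<subseteq> {0<..<T}" if "n \<in> {1..N}" for n
    using time_partition_step[OF t that] by auto
  have A: "?I n \<in> sets ?M1" if "n \<in> {1..N}" for n
    using sub[OF that] by (simp add: sets_restrict_space_iff)
  have m: "tstep t n = measure ?M1 (?I n)" if "n \<in> {1..N}" for n
    using sub[OF that] time_partition_step[OF t that] by (simp add: measure_restrict_space tstep_def)
  have tm: "time_mean t f n = (\<lambda>x. (\<integral>s. indicator (?I n) s * f s x \<partial>?M1) / tstep t n)" if "n \<in> {1..N}" for n
  proof
    fix x
    have "(\<integral>s. indicator (?I n) s * f s x \<partial>?M1) = (\<integral>s. indicator {0<..<T} s *\<^sub>R (indicator (?I n) s * f s x) \<partial>lebesgue)"
      by (rule integral_restrict_space) simp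
    also have "(\<lambda>s. indicator {0<..<T} s *\<^sub>R (indicator (?I n) s * f s x)) = (\<lambda>s. indicator (?I n) s *\<^sub>R f s x)"
      using sub[OF that] by (auto simp: indicator_def fun_eq_iff)
    finally show "time_mean t f n x = (\<integral>s. indicator (?I n) s * f s x \<partial>?M1) / tstep t n"
      by (simp add: time_mean_def set_lebesgue_integral_def)
  qed
  note pm = partial_mean_square[OF fin f' A m time_partition_step(4)[OF t]]
  have LI: "(LINT x:\<Omega>|lebesgue. u x) = (\<integral>x. u x \<partial>?M2)" for u :: "'a \<Rightarrow> real"
    unfolding set_lebesgue_integral_def by (rule integral_restrict_space[OF \<Omega>_sets, symmetric])
  show "set_integrable lebesgue \<Omega> (time_mean t f n)"
    "set_integrable lebesgue \<Omega> (\<lambda>x. (time_mean t f n x)\<^sup>2)" if "n \<in> {1..N}"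
    unfolding set_integrable_eq[OF \<Omega>_sets] tm[OF that] by (rule pm[OF that that that])+
  have "(\<Sum>n=1..N. tstep t n * (LINT x:\<Omega>|lebesgue. (time_mean t f n x)\<^sup>2))
    \<le> (\<Sum>n=1..N. \<integral>(s, x). indicator (?I n) s * (f s x)\<^sup>2 \<partial>(?M1 \<Otimes>\<^sub>M ?M2))"
    unfolding LI by (intro sum_mono, subst tm, assumption) (rule pm(4); assumption)
  also have "\<dots> = (\<integral>p. (\<Sum>n=1..N. (case p of (s, x) \<Rightarrow> indicator (?I n) s * (f s x)\<^sup>2)) \<partial>(?M1 \<Otimes>\<^sub>M ?M2))"
    by (rule Bochner_Integration.integral_sum[symmetric]) (rule pm(3))
  also have "\<dots> \<le> (\<integral>(s, x). (f s x)\<^sup>2 \<partial>(?M1 \<Otimes>\<^sub>M ?M2))"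
  proof (rule integral_mono[OF _ f'(2)])
    show "integrable (?M1 \<Otimes>\<^sub>M ?M2) (\<lambda>p. \<Sum>n=1..N. (case p of (s, x) \<Rightarrow> indicator (?I n) s * (f s x)\<^sup>2))"
      by (intro Bochner_Integration.integrable_sum pm(3))
    fix p :: "real \<times> 'a"
    obtain s x where p: "p = (s, x)" by fastforce
    have "disjoint_family_on ?I {1..N}"
      unfolding disjoint_family_on_def
    proof (intro ballI impI)
      have *: "?I i \<inter> ?I j = {}" if "i < j" "i \<in> {1..N}" "j \<in> {1..N}" for i j
      proof -
        have "t i \<le> t (j - 1)" using time_partition_mono[OF t, of i "j - 1"] that by auto
        then have "s \<notin> ?I j" if "s \<in> ?I i" for s using that by auto
        then show ?thesis by blast
      qed
      show "?I i \<inter> ?I j = {}" if "i \<noteq> j" "i \<in> {1..N}" "j \<in> {1..N}" for i j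
        using *[of i j] *[of j i] that by (cases i j rule: linorder_cases) auto
    qed
    then have "(\<Sum>n=1..N. indicator (?I n) s :: real) = indicator (\<Union>n\<in>{1..N}. ?I n) s"
      by (rule indicator_UN_disjoint[symmetric, OF finite_atLeastAtMost])
    also have "\<dots> \<le> 1" by (rule indicator_le_1)
    finally have "(\<Sum>n=1..N. indicator (?I n) s) * (f s x)\<^sup>2 \<le> 1 * (f s x)\<^sup>2"
      by (intro mult_right_mono) auto
    then show "(\<Sum>n=1..N. (case p of (s, x) \<Rightarrow> indicator (?I n) s * (f s x)\<^sup>2)) \<le> (case p of (s, x) \<Rightarrow> (f s x)\<^sup>2)"
      by (simp add: p sum_distrib_right)
  qed
  finally show "(\<Sum>n=1..N. tstep t n * (LINT x:\<Omega>|lebesgue. (time_mean t f n x)\<^sup>2))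
      \<le> (\<integral>(s, x). (f s x)\<^sup>2 \<partial>(?M1 \<Otimes>\<^sub>M ?M2))" .
qed

section \<open>Energy estimates\<close>

text \<open>The implicit term is absorbed on the left, leaving the factor 1 - \<tau>. For \<tau>
  \<le> 1/2 one has 1 \<le> (1 - \<tau>)(1 + 2\<tau>) \<le> (1 - \<tau>) exp(2\<tau>), so a step
  costs a factor exp(2\<tau>). \<open>t n \<ge> 0\<close> is carried along to let
  \<open>exp (2 * t n) \<ge> 1\<close> absorb the new source term.\<close>

lemma discrete_gronwall:
  fixes a F \<tau> t :: "nat \<Rightarrow> real"
  assumes t0: "t 0 = 0" and t: "\<And>n. n \<in> {1..N} \<Longrightarrow> t n = t (n - 1) + \<tau> n"
    and \<tau>: "\<And>n. n \<in> {1..N} \<Longrightarrow> 0 \<le> \<tau> n \<and> \<tau> n \<le> 1 / 2"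
    and F: "\<And>n. n \<in> {1..N} \<Longrightarrow> F n \<ge> 0" and a0: "a 0 \<ge> 0"
    and step: "\<And>n. n \<in> {1..N} \<Longrightarrow> a n - a (n - 1) \<le> \<tau> n * F n + \<tau> n * a n"
    and n: "n \<le> N"
  shows "t n \<ge> 0 \<and> a n \<le> exp (2 * t n) * (a 0 + (\<Sum>i=1..n. \<tau> i * F i))"
  using n
proof (induction n)
  case (Suc n)
  then have n: "Suc n \<in> {1..N}" by simp
  let ?\<tau> = "\<tau> (Suc n)" and ?S = "a 0 + (\<Sum>i=1..n. \<tau> i * F i)"
  have IH: "t n \<ge> 0" "a n \<le> exp (2 * t n) * ?S" using Suc by auto
  have \<tau>n: "0 \<le> ?\<tau>" "?\<tau> \<le> 1 / 2" using \<tau>[OF n] by auto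
  have tn: "t (Suc n) = t n + ?\<tau>" using t[OF n] by simp
  have S0: "?S \<ge> 0"
    using a0 \<tau> F Suc.prems by (intro add_nonneg_nonneg sum_nonneg mult_nonneg_nonneg) auto
  have F0: "?\<tau> * F (Suc n) \<ge> 0" using \<tau>n F[OF n] by simp
  have "1 \<le> (1 - ?\<tau>) * (1 + 2 * ?\<tau>)"
    using mult_left_mono[OF \<tau>n(2) \<tau>n(1)] by (simp add: algebra_simps)
  also have "\<dots> \<le> (1 - ?\<tau>) * exp (2 * ?\<tau>)"
    using \<tau>n exp_ge_add_one_self[of "2 * ?\<tau>"] by (intro mult_left_mono) auto
  finally have e: "1 \<le> (1 - ?\<tau>) * exp (2 * ?\<tau>)" .
  have "(1 - ?\<tau>) * a (Suc n) \<le> a n + ?\<tau> * F (Suc n)"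
    using step[OF n] by (simp add: algebra_simps)
  also have "\<dots> \<le> exp (2 * t n) * ?S + exp (2 * t n) * (?\<tau> * F (Suc n))"
    using IH F0 mult_right_mono[of 1 "exp (2 * t n)" "?\<tau> * F (Suc n)"] by (intro add_mono) auto
  also have "\<dots> = exp (2 * t n) * (?S + ?\<tau> * F (Suc n))"
    by (simp add: algebra_simps)
  also have "\<dots> \<le> ((1 - ?\<tau>) * exp (2 * ?\<tau>)) * (exp (2 * t n) * (?S + ?\<tau> * F (Suc n)))"
    using mult_right_mono[OF e, of "exp (2 * t n) * (?S + ?\<tau> * F (Suc n))"] S0 F0 by simp
  also have "\<dots> = (1 - ?\<tau>) * (exp (2 * t (Suc n)) * (?S + ?\<tau> * F (Suc n)))"
    by (simp add: tn distrib_left exp_add)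
  finally have "a (Suc n) \<le> exp (2 * t (Suc n)) * (?S + ?\<tau> * F (Suc n))"
    using \<tau>n by (simp add: mult_le_cancel_left)
  then show ?case using IH \<tau>n tn by (simp add: add.assoc)
qed (simp add: t0 a0)

lemma Lp_norm_2: "(Lp_norm 2 \<Omega> u)\<^sup>2 = (LINT x:\<Omega>|lebesgue. (u x)\<^sup>2)"
  and Lp_norm_2_sqrt: "Lp_norm 2 \<Omega> u = sqrt (LINT x:\<Omega>|lebesgue. (u x)\<^sup>2)"
  for u :: "'a::euclidean_space \<Rightarrow> real"
proof -
  have *: "norm (u x) powr 2 = (u x)\<^sup>2" for x by simp
  have nn: "(LINT x:\<Omega>|lebesgue. (u x)\<^sup>2) \<ge> 0"
    unfolding set_lebesgue_integral_def by (intro Bochner_Integration.integral_nonneg) auto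
  show s: "Lp_norm 2 \<Omega> u = sqrt (LINT x:\<Omega>|lebesgue. (u x)\<^sup>2)"
    unfolding Lp_norm_def * using nn by (simp add: powr_half_sqrt)
  show "(Lp_norm 2 \<Omega> u)\<^sup>2 = (LINT x:\<Omega>|lebesgue. (u x)\<^sup>2)"
    unfolding s using nn by simp
qed

lemma Lp_norm_powr:
  assumes "r > 0"
  shows "Lp_norm r \<Omega> u powr r = (LINT x:\<Omega>|lebesgue. norm (u x) powr r)"
proof -
  have "(LINT x:\<Omega>|lebesgue. norm (u x) powr r) \<ge> 0"
    unfolding set_lebesgue_integral_def by (intro Bochner_Integration.integral_nonneg) auto
  then show ?thesis
    using assms by (simp add: Lp_norm_def powr_powr)
qed

context mesh
begin

text \<open>
  Convexity bounds the field on an element by its values at the vertices. Estimating the maximum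
  by the sum loses a factor \<open>d + 1\<close> against the vertex quadrature but needs no exact integration.
\<close>

lemma power_integral_le_quadrature:
  assumes g: "represents g W Q" and r: "r > 0"
  shows "set_integrable lebesgue \<Omega> (\<lambda>x. norm (Q x) powr r)"
    and "(LINT x:\<Omega>|lebesgue. norm (Q x) powr r)
      \<le> (\<Sum>\<sigma>\<in>\<T>. measure lebesgue \<sigma> * (\<Sum>x\<in>vertices \<sigma>. norm (rt_val (g \<sigma>) x) powr r))"
proof -
  define B where "B \<sigma> = (\<Sum>x\<in>vertices \<sigma>. norm (rt_val (g \<sigma>) x) powr r)" for \<sigma>
  have bound: "norm (Q x) powr r \<le> B \<sigma>" if \<sigma>: "\<sigma> \<in> \<T>" and x: "x \<in> \<sigma>" for \<sigma> x
  proof -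
    let ?N = "(\<lambda>y. norm (rt_val (g \<sigma>) y)) ` vertices \<sigma>"
    have fin: "finite ?N" "?N \<noteq> {}"
      using vertices_element(3,4)[OF \<sigma>] by auto
    have "vertices \<sigma> \<subseteq> {y. norm (rt_val (g \<sigma>) y) \<le> Max ?N}"
      using fin by auto
    then have "closure \<sigma> \<subseteq> {y. norm (rt_val (g \<sigma>) y) \<le> Max ?N}"
      unfolding vertices_element(1)[OF \<sigma>] by (rule hull_minimal) (rule convex_norm_rt_val_le)
    then have "norm (Q x) \<le> Max ?N"
      using x g \<sigma> closure_subset[of \<sigma>] by (auto simp: represents_def)
    moreover obtain y where y: "y \<in> vertices \<sigma>" "Max ?N = norm (rt_val (g \<sigma>) y)"
      using Max_in[OF fin] by auto
    ultimately have "norm (Q x) powr r \<le> norm (rt_val (g \<sigma>) y) powr r"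
      using r by (intro powr_mono2) auto
    also have "\<dots> \<le> B \<sigma>"
      unfolding B_def using y(1) vertices_element(3)[OF \<sigma>] by (intro member_le_sum) auto
    finally show ?thesis .
  qed
  have int: "set_integrable lebesgue \<sigma> (\<lambda>x. norm (Q x) powr r)" if \<sigma>: "\<sigma> \<in> \<T>" for \<sigma>
  proof (rule set_integrable_bound)
    show "set_integrable lebesgue \<sigma> (\<lambda>x. B \<sigma>)"
      by (rule set_integral_element(1)[OF \<sigma> refl])
    \<comment> \<open>Off the element nothing is known about \<open>Q\<close>; measurability is
      obtained for the polynomial and transferred through the indicator.\<close>
    have "continuous_on UNIV (rt_val (g \<sigma>))"
      by (simp add: continuous_on_eq_continuous_at isCont_rt_val)
    then have "continuous_on UNIV (\<lambda>x. norm (rt_val (g \<sigma>) x) powr r)"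
      using r by (intro continuous_on_powr' continuous_on_norm continuous_on_const) auto
    then have "(\<lambda>x. norm (rt_val (g \<sigma>) x) powr r) \<in> borel_measurable lebesgue"
      by (intro measurable_completion) (simp add: borel_measurable_continuous_onI)
    then have "set_borel_measurable lebesgue \<sigma> (\<lambda>x. norm (rt_val (g \<sigma>) x) powr r)"
      unfolding set_borel_measurable_def using element_sets[OF \<sigma>] by (intro borel_measurable_scaleR) auto
    moreover have "(\<lambda>x. indicator \<sigma> x *\<^sub>R (norm (rt_val (g \<sigma>) x) powr r)) = (\<lambda>x. indicator \<sigma> x *\<^sub>R (norm (Q x) powr r))"
      using g \<sigma> by (auto simp: fun_eq_iff indicator_def represents_def)
    ultimately show "set_borel_measurable lebesgue \<sigma> (\<lambda>x. norm (Q x) powr r)"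
      unfolding set_borel_measurable_def by metis
    show "AE x in lebesgue. x \<in> \<sigma> \<longrightarrow> norm (norm (Q x) powr r) \<le> norm (B \<sigma>)"
      using bound[OF \<sigma>] by (intro AE_I2) force
  qed
  then show int\<Omega>: "set_integrable lebesgue \<Omega> (\<lambda>x. norm (Q x) powr r)"
    by (simp add: set_integrable_mesh_iff)
  show "(LINT x:\<Omega>|lebesgue. norm (Q x) powr r)
      \<le> (\<Sum>\<sigma>\<in>\<T>. measure lebesgue \<sigma> * (\<Sum>x\<in>vertices \<sigma>. norm (rt_val (g \<sigma>) x) powr r))"
    unfolding set_integral_mesh[OF int\<Omega>] B_def[symmetric]
  proof (rule sum_mono)
    fix \<sigma> assume \<sigma>: "\<sigma> \<in> \<T>"
    have "(LINT x:\<sigma>|lebesgue. norm (Q x) powr r) \<le> (LINT x:\<sigma>|lebesgue. B \<sigma>)"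
      by (rule set_integral_mono[OF int[OF \<sigma>] set_integral_element(1)[OF \<sigma> refl] bound[OF \<sigma>]])
    also have "\<dots> = measure lebesgue \<sigma> * B \<sigma>"
      by (rule set_integral_element(2)[OF \<sigma> refl])
    finally show "(LINT x:\<sigma>|lebesgue. norm (Q x) powr r) \<le> measure lebesgue \<sigma> * B \<sigma>" .
  qed
qed

text \<open>The quadrature weight is the volume over d + 1, while the integral bound sums vertex
  values with the full volume; their ratio gives the constant.\<close>

lemma quad_inner_coercive:
  assumes r: "1 < r" and k0: "k0 > 0" and \<epsilon>: "\<epsilon> > 0" and WQ: "W \<in> S_space \<T>" "Q \<in> V_space \<T>"
  shows "k0 / (real DIM('a) + 1) * (LINT x:\<Omega>|lebesgue. norm (Q x) powr r)
    \<le> quad_inner \<T> (\<lambda>x. M_op \<Omega> \<T> k0 \<epsilon> w0 W x *\<^sub>R (norm (Q x) powr (r - 2) *\<^sub>R Q x)) Q"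
proof -
  obtain g where g: "represents g W Q"
    using discrete_state_exists[OF WQ] by blast
  obtain \<mu> where "\<forall>\<sigma>\<in>\<T>. continuous_on UNIV (\<mu> \<sigma>) \<and> (\<forall>s. \<mu> \<sigma> s \<ge> k0) \<and>
      (\<forall>x\<in>\<sigma>. \<forall>W. M_op \<Omega> \<T> k0 \<epsilon> w0 W x = \<mu> \<sigma> (W x))"
    using M_op_coefficient[OF \<epsilon>, of k0 w0] by (elim exE)
  then have \<mu>: "\<And>\<sigma> s. \<sigma> \<in> \<T> \<Longrightarrow> \<mu> \<sigma> s \<ge> k0"
    "\<And>\<sigma> x. \<sigma> \<in> \<T> \<Longrightarrow> x \<in> \<sigma> \<Longrightarrow> M_op \<Omega> \<T> k0 \<epsilon> w0 W x = \<mu> \<sigma> (fst (g \<sigma>))"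
    using g by (auto simp: represents_def)
  have "k0 / (real DIM('a) + 1) * (LINT x:\<Omega>|lebesgue. norm (Q x) powr r)
    \<le> k0 / (real DIM('a) + 1) * (\<Sum>\<sigma>\<in>\<T>. measure lebesgue \<sigma> * (\<Sum>x\<in>vertices \<sigma>. norm (rt_val (g \<sigma>) x) powr r))"
    using power_integral_le_quadrature(2)[OF g, of r] r k0 by (intro mult_left_mono) auto
  also have "\<dots> = (\<Sum>\<sigma>\<in>\<T>. measure lebesgue \<sigma> / (real DIM('a) + 1) * k0 * (\<Sum>x\<in>vertices \<sigma>. norm (rt_val (g \<sigma>) x) powr r))"
    unfolding sum_distrib_left[of "k0 / (real DIM('a) + 1)"] by (intro sum.cong refl) simp
  also have "\<dots> \<le> (\<Sum>\<sigma>\<in>\<T>. measure lebesgue \<sigma> / (real DIM('a) + 1) * \<mu> \<sigma> (fst (g \<sigma>)) * (\<Sum>x\<in>vertices \<sigma>. norm (rt_val (g \<sigma>) x) powr r))"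
    using \<mu>(1) by (intro sum_mono mult_right_mono mult_left_mono sum_nonneg) auto
  also have "\<dots> = quad_inner \<T> (\<lambda>x. M_op \<Omega> \<T> k0 \<epsilon> w0 W x *\<^sub>R (norm (Q x) powr (r - 2) *\<^sub>R Q x)) Q"
    by (subst quad_inner_flux[where m = "\<lambda>\<sigma>. \<mu> \<sigma> (fst (g \<sigma>))", OF r g g])
      (auto intro: \<mu>(2) simp only: powr_field_inner)
  finally show ?thesis .
qed

text \<open>The flux equation tested with \<open>Q\<close> turns the coupling term of the balance
  equation into the coercive form. The identity 2(a - b)a = a^2 - b^2 + (a - b)^2 prepares the
  telescoping, and Young's inequality splits the source into the two terms suited to
  Gronwall.\<close>

lemma step_energy:
  assumes step: "Q_step \<Omega> \<T> k0 \<epsilon> w0 f t r n Wp W Q" and Wp: "Wp \<in> S_space \<T>"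
    and pos: "k0 > 0" "\<epsilon> > 0" "tstep t n > 0" and r: "1 < r"
    and f: "set_integrable lebesgue \<Omega> (time_mean t f n)"
      "set_integrable lebesgue \<Omega> (\<lambda>x. (time_mean t f n x)\<^sup>2)"
  defines "N2 \<equiv> \<lambda>u. LINT x:\<Omega>|lebesgue. (u x)\<^sup>2"
  shows "N2 W - N2 Wp + N2 (\<lambda>x. W x - Wp x)
      + 2 * k0 / (real DIM('a) + 1) * (tstep t n * (LINT x:\<Omega>|lebesgue. norm (Q x) powr r))
      \<le> tstep t n * N2 (time_mean t f n) + tstep t n * N2 W"
    and "(tstep t n)\<^sup>2 * N2 (divergence Q) \<le> 2 * N2 (\<lambda>x. W x - Wp x) + 2 * (tstep t n)\<^sup>2 * N2 (time_mean t f n)"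
proof -
  let ?\<tau> = "tstep t n" and ?f = "time_mean t f n" and ?D = "divergence Q"
  let ?I = "\<lambda>u. LINT x:\<Omega>|lebesgue. u x"
  have W: "W \<in> S_space \<T>" and Q: "Q \<in> V_space \<T>"
    using step by (auto simp: Q_step_def)
  obtain g where g: "represents g W Q" using discrete_state_exists[OF W Q] by blast
  have Wg: "W x = fst (g \<sigma>)" if "\<sigma> \<in> \<T>" "x \<in> \<sigma>" for \<sigma> x
    using g that by (auto simp: represents_def)
  have Dg: "?D x = rt_div (g \<sigma>)" if "\<sigma> \<in> \<T>" "x \<in> \<sigma>" for \<sigma> x
    by (rule represents_divergence[OF g that])
  obtain p where p: "\<And>\<sigma> x. \<sigma> \<in> \<T> \<Longrightarrow> x \<in> \<sigma> \<Longrightarrow> Wp x = p \<sigma>"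
    using S_space_E[OF Wp] by metis
  have D: "?D \<in> S_space \<T>"
    using Dg by (auto simp: S_space_def constant_on_def)
  have eq1: "?I (\<lambda>x. (W x - Wp x) / ?\<tau> * \<eta> x) + ?I (\<lambda>x. ?D x * \<eta> x) = ?I (\<lambda>x. ?f x * \<eta> x)" if "\<eta> \<in> S_space \<T>" for \<eta>
    using step that unfolding Q_step_def L2_inner_def by blast
  have eq2: "quad_inner \<T> (\<lambda>x. M_op \<Omega> \<T> k0 \<epsilon> w0 W x *\<^sub>R (norm (Q x) powr (r - 2) *\<^sub>R Q x)) Q
      = ?I (\<lambda>x. W x * ?D x)"
    using step Q unfolding Q_step_def L2_inner_def by simp
  have iW: "set_integrable lebesgue \<Omega> (\<lambda>x. (W x)\<^sup>2)" by (rule set_integrable_S) (simp add: Wg)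
  have iWp: "set_integrable lebesgue \<Omega> (\<lambda>x. (Wp x)\<^sup>2)" by (rule set_integrable_S) (simp add: p)
  have id: "set_integrable lebesgue \<Omega> (\<lambda>x. (W x - Wp x)\<^sup>2)" by (rule set_integrable_S) (simp add: Wg p)
  have iD: "set_integrable lebesgue \<Omega> (\<lambda>x. (?D x)\<^sup>2)" by (rule set_integrable_S) (simp add: Dg)
  have idW: "set_integrable lebesgue \<Omega> (\<lambda>x. (W x - Wp x) * W x)" by (rule set_integrable_S) (simp add: Wg p)
  have idD: "set_integrable lebesgue \<Omega> (\<lambda>x. (W x - Wp x) * ?D x)" by (rule set_integrable_S) (simp add: Wg Dg p)
  have ifW: "set_integrable lebesgue \<Omega> (\<lambda>x. ?f x * W x)" by (rule set_integrable_mult_S[OF f(1) Wg])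
  have ifD: "set_integrable lebesgue \<Omega> (\<lambda>x. ?f x * ?D x)" by (rule set_integrable_mult_S[OF f(1) Dg])
  have "?I (\<lambda>x. (W x - Wp x) * W x) = ?I (\<lambda>x. ((W x)\<^sup>2 - (Wp x)\<^sup>2 + (W x - Wp x)\<^sup>2) / 2)"
    by (intro arg_cong[where f = "set_lebesgue_integral lebesgue \<Omega>"]) (auto simp: fun_eq_iff power2_eq_square field_simps)
  also have "\<dots> = (N2 W - N2 Wp + N2 (\<lambda>x. W x - Wp x)) / 2"
    unfolding N2_def using iW iWp id by simp
  finally have 1: "2 * ?I (\<lambda>x. (W x - Wp x) * W x) = N2 W - N2 Wp + N2 (\<lambda>x. W x - Wp x)" by simp
  have "?I (\<lambda>x. ?f x * W x) \<le> ?I (\<lambda>x. ((?f x)\<^sup>2 + (W x)\<^sup>2) / 2)"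
  proof (rule set_integral_mono[OF ifW])
    show "set_integrable lebesgue \<Omega> (\<lambda>x. ((?f x)\<^sup>2 + (W x)\<^sup>2) / 2)" using f(2) iW by simp
    show "?f x * W x \<le> ((?f x)\<^sup>2 + (W x)\<^sup>2) / 2" for x
      using sum_squares_bound[of "?f x" "W x"] by simp
  qed
  also have "\<dots> = (N2 ?f + N2 W) / 2"
    unfolding N2_def using f(2) iW by simp
  finally have 2: "2 * ?I (\<lambda>x. ?f x * W x) \<le> N2 ?f + N2 W" by simp
  have "?I (\<lambda>x. (W x - Wp x) * W x) / ?\<tau> + ?I (\<lambda>x. W x * ?D x) = ?I (\<lambda>x. ?f x * W x)"
    using eq1[OF W] by (simp add: mult.commute[of "W _"] times_divide_eq_left)
  then have "?I (\<lambda>x. (W x - Wp x) * W x) + ?\<tau> * ?I (\<lambda>x. W x * ?D x) = ?\<tau> * ?I (\<lambda>x. ?f x * W x)"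
    using pos(3) by (simp add: field_simps)
  moreover have "?\<tau> * (k0 / (real DIM('a) + 1) * ?I (\<lambda>x. norm (Q x) powr r)) \<le> ?\<tau> * ?I (\<lambda>x. W x * ?D x)"
    using quad_inner_coercive[OF r pos(1,2) W Q, of w0] pos(3) unfolding eq2 by (intro mult_left_mono) auto
  moreover have "2 * (?\<tau> * ?I (\<lambda>x. ?f x * W x)) \<le> ?\<tau> * N2 ?f + ?\<tau> * N2 W"
    using mult_left_mono[OF 2, of ?\<tau>] pos(3) by (simp add: distrib_left)
  moreover have "2 * k0 / (real DIM('a) + 1) * (?\<tau> * ?I (\<lambda>x. norm (Q x) powr r))
      = 2 * (?\<tau> * (k0 / (real DIM('a) + 1) * ?I (\<lambda>x. norm (Q x) powr r)))"
    by simp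
  ultimately show "N2 W - N2 Wp + N2 (\<lambda>x. W x - Wp x)
      + 2 * k0 / (real DIM('a) + 1) * (?\<tau> * ?I (\<lambda>x. norm (Q x) powr r)) \<le> ?\<tau> * N2 ?f + ?\<tau> * N2 W"
    using 1 by linarith
  have "?I (\<lambda>x. (W x - Wp x) * ?D x) / ?\<tau> + N2 ?D = ?I (\<lambda>x. ?f x * ?D x)"
    using eq1[OF D] by (simp add: N2_def power2_eq_square times_divide_eq_left)
  then have "?\<tau> * N2 ?D = ?\<tau> * ?I (\<lambda>x. ?f x * ?D x) - ?I (\<lambda>x. (W x - Wp x) * ?D x)"
    using pos(3) by (simp add: field_simps)
  then have "?\<tau>\<^sup>2 * N2 ?D = ?\<tau> * (?\<tau> * ?I (\<lambda>x. ?f x * ?D x) - ?I (\<lambda>x. (W x - Wp x) * ?D x))"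
    unfolding power2_eq_square mult.assoc by (rule arg_cong)
  also have "\<dots> = ?I (\<lambda>x. ?\<tau> * (?\<tau> * (?f x * ?D x) - (W x - Wp x) * ?D x))"
    using ifD idD by simp
  also have "\<dots> \<le> ?I (\<lambda>x. ?\<tau>\<^sup>2 * (?f x)\<^sup>2 + (W x - Wp x)\<^sup>2 + ?\<tau>\<^sup>2 * (?D x)\<^sup>2 / 2)"
  proof (rule set_integral_mono)
    show "set_integrable lebesgue \<Omega> (\<lambda>x. ?\<tau> * (?\<tau> * (?f x * ?D x) - (W x - Wp x) * ?D x))"
      using ifD idD by simp
    show "set_integrable lebesgue \<Omega> (\<lambda>x. ?\<tau>\<^sup>2 * (?f x)\<^sup>2 + (W x - Wp x)\<^sup>2 + ?\<tau>\<^sup>2 * (?D x)\<^sup>2 / 2)"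
      using f(2) id iD by simp
    fix x
    let ?a = "?\<tau> * ?f x" and ?b = "W x - Wp x" and ?d = "?\<tau> * ?D x"
    \<comment> \<open>A sum-of-squares form of Young's inequality. Its coefficient leaves half of
      \<open>?d\<^sup>2\<close>, which the left side absorbs.\<close>
    have "0 \<le> (?a - ?b - ?d)\<^sup>2 + (?a + ?b)\<^sup>2" by simp
    then have "2 * ((?a - ?b) * ?d) \<le> 2 * ?a\<^sup>2 + 2 * ?b\<^sup>2 + ?d\<^sup>2"
      by (simp add: power2_eq_square algebra_simps)
    then show "?\<tau> * (?\<tau> * (?f x * ?D x) - (W x - Wp x) * ?D x)
        \<le> ?\<tau>\<^sup>2 * (?f x)\<^sup>2 + (W x - Wp x)\<^sup>2 + ?\<tau>\<^sup>2 * (?D x)\<^sup>2 / 2"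
      by (simp add: power2_eq_square algebra_simps)
  qed
  also have "\<dots> = ?\<tau>\<^sup>2 * N2 ?f + N2 (\<lambda>x. W x - Wp x) + ?\<tau>\<^sup>2 * N2 ?D / 2"
    unfolding N2_def using f(2) id iD by simp
  finally show "?\<tau>\<^sup>2 * N2 ?D \<le> 2 * N2 (\<lambda>x. W x - Wp x) + 2 * ?\<tau>\<^sup>2 * N2 ?f"
    by simp
qed

text \<open>Neither nodal interpolation nor taking element means increases the maximum, so the
  discrete initial norm is bounded uniformly over meshes.\<close>

lemma initial_bound:
  assumes "\<And>x. x \<in> closure \<Omega> \<Longrightarrow> \<bar>w0 x\<bar> \<le> B"
  shows "(LINT x:\<Omega>|lebesgue. (elem_mean \<T> (nodal_interp \<Omega> \<T> w0) x)\<^sup>2) \<le> measure lebesgue \<Omega> * B\<^sup>2"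
proof -
  let ?u = "nodal_interp \<Omega> \<T> w0"
  have B: "B \<ge> 0"
    using assms nonempty_domain closure_subset[of \<Omega>] by (metis abs_ge_zero all_not_in_conv order_trans subset_iff)
  define c where "c \<sigma> = (LINT y:\<sigma>|lebesgue. ?u y) / measure lebesgue \<sigma>" for \<sigma>
  have c: "elem_mean \<T> ?u x = c \<sigma>" if "\<sigma> \<in> \<T>" "x \<in> \<sigma>" for \<sigma> x
    unfolding c_def by (rule elem_mean_eq[OF that])
  have cB: "(c \<sigma>)\<^sup>2 \<le> B\<^sup>2" if \<sigma>: "\<sigma> \<in> \<T>" for \<sigma>
  proof -
    have "\<bar>LINT y:\<sigma>|lebesgue. ?u y\<bar> \<le> measure lebesgue \<sigma> * B"
    proof (cases "set_integrable lebesgue \<sigma> ?u")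
      case True
      have "\<bar>LINT y:\<sigma>|lebesgue. ?u y\<bar> \<le> (LINT y:\<sigma>|lebesgue. \<bar>?u y\<bar>)"
        using set_integral_norm_bound[OF True] by simp
      also have "\<dots> \<le> (LINT y:\<sigma>|lebesgue. B)"
        by (rule set_integral_mono[OF set_integrable_abs[OF True] set_integral_element(1)[OF \<sigma> refl]
              nodal_interp_bound[OF assms \<sigma>]])
      also have "\<dots> = measure lebesgue \<sigma> * B" by (rule set_integral_element(2)[OF \<sigma> refl])
      finally show ?thesis .
    next
      \<comment> \<open>The integral of a nonintegrable function is 0 by convention, so the bound
        persists.\<close>
      case False
      then show ?thesis
        using B by (simp add: set_lebesgue_integral_def set_integrable_def not_integrable_integral_eq)
    qed
    then have "\<bar>c \<sigma>\<bar> \<le> B"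
      using measure_element_pos[OF \<sigma>] by (simp add: c_def field_simps)
    then show ?thesis using B abs_le_square_iff[of "c \<sigma>" B] by simp
  qed
  have i: "set_integrable lebesgue \<Omega> (\<lambda>x. (elem_mean \<T> ?u x)\<^sup>2)"
    by (rule set_integrable_S) (simp add: c)
  have iB: "set_integrable lebesgue \<Omega> (\<lambda>x. B\<^sup>2)"
    by (rule set_integrable_S) simp
  have "(LINT x:\<Omega>|lebesgue. (elem_mean \<T> ?u x)\<^sup>2) \<le> (LINT x:\<Omega>|lebesgue. B\<^sup>2)"
    unfolding set_integral_mesh[OF i] set_integral_mesh[OF iB]
  proof (rule sum_mono)
    fix \<sigma> assume \<sigma>: "\<sigma> \<in> \<T>"
    show "(LINT x:\<sigma>|lebesgue. (elem_mean \<T> ?u x)\<^sup>2) \<le> (LINT x:\<sigma>|lebesgue. B\<^sup>2)"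
      using i iB \<sigma> c cB by (intro set_integral_mono) (auto simp: set_integrable_mesh_iff)
  qed
  also have "\<dots> = measure lebesgue \<Omega> * B\<^sup>2"
    using lmeasurable_domain by (subst set_integral_const) (auto simp: fmeasurable_def)
  finally show ?thesis .
qed


lemma Q_solution_S:
  assumes "Q_solution \<Omega> \<T> k0 \<epsilon> w0 f t r m W Q" "n \<le> m"
  shows "W n \<in> S_space \<T>"
proof (cases "n = 0")
  case True
  then show ?thesis using assms(1) elem_mean_S by (simp add: Q_solution_def)
next
  case False
  then have "n \<in> {1..m}" using assms(2) by simp
  then have "Q_step \<Omega> \<T> k0 \<epsilon> w0 f t r n (W (n - 1)) (W n) (Q n)"
    using assms(1) unfolding Q_solution_def by blast
  then show ?thesis by (simp add: Q_step_def)
qed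

text \<open>\<open>E\<close> is the Gronwall bound for the squared norms. Inserting it into the
  implicit term before summing yields \<open>T * E\<close>, the last summand of \<open>S\<close>.
  The divergence bound takes \<open>2 * S\<close> from the differences and \<open>Fb\<close> from
  the source.\<close>

lemma energy_estimate:
  assumes sol: "Q_solution \<Omega> \<T> k0 \<epsilon> w0 f t r N W Q"
    and pos: "k0 > 0" "\<epsilon> > 0" and r: "1 < r" and f: "f \<in> L2_L2 T \<Omega>"
    and t: "time_partition T N t" and \<tau>: "\<And>n. n \<in> {1..N} \<Longrightarrow> tstep t n \<le> 1 / 2"
    and B: "\<And>x. x \<in> closure \<Omega> \<Longrightarrow> \<bar>w0 x\<bar> \<le> B"
  defines "Fb \<equiv> \<integral>(s, x). (f s x)\<^sup>2 \<partial>(lebesgue_on {0<..<T} \<Otimes>\<^sub>M lebesgue_on \<Omega>)"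
  defines "E \<equiv> exp (2 * T) * (measure lebesgue \<Omega> * B\<^sup>2 + Fb)"
  defines "S \<equiv> measure lebesgue \<Omega> * B\<^sup>2 + Fb + T * E"
  shows "n \<le> N \<Longrightarrow> Lp_norm 2 \<Omega> (W n) \<le> 1 + E"
    and "(\<Sum>n=1..N. (Lp_norm 2 \<Omega> (\<lambda>x. W n x - W (n - 1) x))\<^sup>2)
      + 2 * k0 / (real DIM('a) + 1) * (\<Sum>n=1..N. tstep t n * Lp_norm r \<Omega> (Q n) powr r) \<le> S"
    and "(\<Sum>n=1..N. (tstep t n)\<^sup>2 * (Lp_norm 2 \<Omega> (divergence (Q n)))\<^sup>2) \<le> 2 * S + Fb"
proof -
  define N2 where "N2 u = (LINT x:\<Omega>|lebesgue. (u x)\<^sup>2)" for u :: "'a \<Rightarrow> real"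
  have N2_nonneg: "N2 u \<ge> 0" for u
    unfolding N2_def Lp_norm_2[symmetric] by simp
  define q where "q n = (LINT x:\<Omega>|lebesgue. norm (Q n x) powr r)" for n
  have q: "Lp_norm r \<Omega> (Q n) powr r = q n" for n
    unfolding q_def using r by (intro Lp_norm_powr) simp
  have q_nonneg: "q n \<ge> 0" for n unfolding q[symmetric] by simp
  let ?d = "\<lambda>n. N2 (\<lambda>x. W n x - W (n - 1) x)"
  let ?c = "2 * k0 / (real DIM('a) + 1)"
  let ?F = "\<lambda>n. N2 (time_mean t f n)"
  have c: "?c > 0" using pos by simp
  have \<tau>0: "tstep t n > 0" if "n \<in> {1..N}" for n using time_partition_step(4)[OF t that] .
  have step: "N2 (W n) - N2 (W (n - 1)) + ?d n + ?c * (tstep t n * q n) \<le> tstep t n * ?F n + tstep t n * N2 (W n)"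
    "(tstep t n)\<^sup>2 * N2 (divergence (Q n)) \<le> 2 * ?d n + 2 * (tstep t n)\<^sup>2 * ?F n" if n: "n \<in> {1..N}" for n
  proof -
    have st: "Q_step \<Omega> \<T> k0 \<epsilon> w0 f t r n (W (n - 1)) (W n) (Q n)"
      using sol n unfolding Q_solution_def by blast
    have Wp: "W (n - 1) \<in> S_space \<T>"
      using n by (intro Q_solution_S[OF sol]) auto
    note e = step_energy[OF st Wp pos \<tau>0[OF n] r time_mean_integrable[OF lmeasurable_domain f t n]
        time_mean_square_integrable[OF lmeasurable_domain f t n]]
    show "N2 (W n) - N2 (W (n - 1)) + ?d n + ?c * (tstep t n * q n) \<le> tstep t n * ?F n + tstep t n * N2 (W n)"
      "(tstep t n)\<^sup>2 * N2 (divergence (Q n)) \<le> 2 * ?d n + 2 * (tstep t n)\<^sup>2 * ?F n"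
      unfolding N2_def q_def by (rule e)+
  qed
  have Fsum: "(\<Sum>n=1..N. tstep t n * ?F n) \<le> Fb"
    unfolding N2_def Fb_def by (rule time_mean_square_sum[OF lmeasurable_domain f t])
  have F_nonneg: "tstep t n * ?F n \<ge> 0" if "n \<in> {1..N}" for n
    using \<tau>0[OF that] N2_nonneg by simp
  have W0: "N2 (W 0) \<le> measure lebesgue \<Omega> * B\<^sup>2"
    using sol initial_bound[OF B] by (simp add: Q_solution_def N2_def)
  have T: "t 0 = 0" "t N = T" using t by (auto simp: time_partition_def)
  have Fb0: "Fb \<ge> 0" using Fsum sum_nonneg[of "{1..N}" "\<lambda>n. tstep t n * ?F n"] F_nonneg by force
  have K0: "measure lebesgue \<Omega> * B\<^sup>2 + Fb \<ge> 0" using Fb0 by simp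
  have aE: "N2 (W n) \<le> E" if "n \<le> N" for n
  proof -
    have "N2 (W n) \<le> exp (2 * t n) * (N2 (W 0) + (\<Sum>i=1..n. tstep t i * ?F i))"
    proof (rule discrete_gronwall[where N = N and a = "\<lambda>n. N2 (W n)" and F = ?F
          and \<tau> = "tstep t" and t = t, THEN conjunct2])
      fix n assume n: "n \<in> {1..N}"
      show "t n = t (n - 1) + tstep t n" by (simp add: tstep_def)
      show "0 \<le> tstep t n \<and> tstep t n \<le> 1 / 2" using \<tau>0[OF n] \<tau>[OF n] by simp
      show "?F n \<ge> 0" by (rule N2_nonneg)
      have "?c * (tstep t n * q n) \<ge> 0" using c \<tau>0[OF n] q_nonneg by (intro mult_nonneg_nonneg) auto
      then show "N2 (W n) - N2 (W (n - 1)) \<le> tstep t n * ?F n + tstep t n * N2 (W n)"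
        using step(1)[OF n] N2_nonneg[of "\<lambda>x. W n x - W (n - 1) x"] by linarith
    qed (use T N2_nonneg that in auto)
    also have "\<dots> \<le> exp (2 * T) * (measure lebesgue \<Omega> * B\<^sup>2 + Fb)"
    proof (rule mult_mono)
      show "exp (2 * t n) \<le> exp (2 * T)"
        using time_partition_mono[OF t that] T by simp
      have "(\<Sum>i=1..n. tstep t i * ?F i) \<le> (\<Sum>i=1..N. tstep t i * ?F i)"
        using that F_nonneg by (intro sum_mono2) auto
      then show "N2 (W 0) + (\<Sum>i=1..n. tstep t i * ?F i) \<le> measure lebesgue \<Omega> * B\<^sup>2 + Fb"
        using W0 Fsum by linarith
      show "0 \<le> N2 (W 0) + (\<Sum>i=1..n. tstep t i * ?F i)"
        using that N2_nonneg F_nonneg by (intro add_nonneg_nonneg sum_nonneg) auto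
    qed simp
    finally show ?thesis unfolding E_def .
  qed
  have E0: "E \<ge> 0" unfolding E_def using K0 by simp
  show "Lp_norm 2 \<Omega> (W n) \<le> 1 + E" if "n \<le> N"
  proof -
    \<comment> \<open>The theorem bounds the norm itself, not its square;
      \<open>E \<le> (1 + E)\<^sup>2\<close> avoids a root in the constant.\<close>
    have "sqrt (N2 (W n)) \<le> 1 + E"
    proof (rule real_le_lsqrt[of _ _, simplified])
      show "N2 (W n) \<le> (1 + E)\<^sup>2"
        using aE[OF that] E0 mult_nonneg_nonneg[OF E0 E0]
        unfolding power2_eq_square distrib_left distrib_right by linarith
    qed (use E0 in auto)
    then show ?thesis by (simp add: Lp_norm_2_sqrt N2_def)
  qed
  have "(\<Sum>n=1..N. N2 (W n) - N2 (W (n - 1)) + ?d n + ?c * (tstep t n * q n))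
      \<le> (\<Sum>n=1..N. tstep t n * ?F n + tstep t n * E)"
  proof (rule sum_mono)
    fix n assume n: "n \<in> {1..N}"
    have "tstep t n * N2 (W n) \<le> tstep t n * E"
      using aE[of n] \<tau>0[OF n] n by (intro mult_left_mono) auto
    then show "N2 (W n) - N2 (W (n - 1)) + ?d n + ?c * (tstep t n * q n) \<le> tstep t n * ?F n + tstep t n * E"
      using step(1)[OF n] by linarith
  qed
  moreover have "(\<Sum>n=1..N. N2 (W n) - N2 (W (n - 1))) = N2 (W N) - N2 (W 0)"
    using sum_telescope''[of 0 N "\<lambda>n. N2 (W n)"] by (simp add: atLeastSucAtMost_greaterThanAtMost[symmetric])
  moreover have "(\<Sum>n=1..N. tstep t n * E) = T * E"
    unfolding sum_distrib_right[symmetric] sum_tstep[OF t order_refl] T ..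
  ultimately have dq: "(\<Sum>n=1..N. ?d n) + ?c * (\<Sum>n=1..N. tstep t n * q n) \<le> S"
    using W0 Fsum N2_nonneg[of "W N"] unfolding S_def
    by (simp add: sum.distrib sum_distrib_left)
  then show "(\<Sum>n=1..N. (Lp_norm 2 \<Omega> (\<lambda>x. W n x - W (n - 1) x))\<^sup>2)
      + ?c * (\<Sum>n=1..N. tstep t n * Lp_norm r \<Omega> (Q n) powr r) \<le> S"
    unfolding q Lp_norm_2 N2_def .
  have "?c * (\<Sum>n=1..N. tstep t n * q n) \<ge> 0"
    using c \<tau>0 q_nonneg by (intro mult_nonneg_nonneg sum_nonneg) (auto simp: less_imp_le)
  then have dS: "(\<Sum>n=1..N. ?d n) \<le> S" using dq by linarith
  have "(\<Sum>n=1..N. (tstep t n)\<^sup>2 * N2 (divergence (Q n))) \<le> (\<Sum>n=1..N. 2 * ?d n + tstep t n * ?F n)"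
  proof (rule sum_mono)
    fix n assume n: "n \<in> {1..N}"
    \<comment> \<open>The restriction on the step size enters a second time: it trades the squared
      weight for the single one in the sum bounded by \<open>Fb\<close>.\<close>
    have "2 * (tstep t n)\<^sup>2 \<le> tstep t n"
      using mult_left_mono[OF \<tau>[OF n], of "tstep t n"] \<tau>0[OF n] by (simp add: power2_eq_square)
    then have "2 * (tstep t n)\<^sup>2 * ?F n \<le> tstep t n * ?F n"
      by (rule mult_right_mono[OF _ N2_nonneg])
    then show "(tstep t n)\<^sup>2 * N2 (divergence (Q n)) \<le> 2 * ?d n + tstep t n * ?F n"
      using step(2)[OF n] by linarith
  qed
  also have "\<dots> \<le> 2 * S + Fb"
    using dS Fsum by (simp add: sum.distrib flip: sum_distrib_left)
  finally show "(\<Sum>n=1..N. (tstep t n)\<^sup>2 * (Lp_norm 2 \<Omega> (divergence (Q n)))\<^sup>2) \<le> 2 * S + Fb"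
    unfolding Lp_norm_2 N2_def .
qed

end

section \<open>Existence and uniform bounds on a family of meshes\<close>

theorem theorem2p3:
  fixes \<Omega> :: "'a::euclidean_space set"
    and T k0 \<epsilon> :: real
    and f :: "real \<Rightarrow> 'a \<Rightarrow> real"
    and w0 :: "'a \<Rightarrow> real"
    and \<F> :: "'a set set set"
  assumes "DIM('a) \<in> {1, 2}"
    and "convex_polygonal_domain \<Omega>"
    and "T > 0" and "k0 > 0" and "\<epsilon> > 0"
    and "f \<in> L2_L2 T \<Omega>"
    and "AE (t, x) in lebesgue_on {0<..<T} \<Otimes>\<^sub>M lebesgue_on \<Omega>. f t x \<ge> 0"
    and "w0 \<in> W1inf0 \<Omega> \<inter> C1_closure \<Omega>"
    and "\<forall>x \<nu>. outward_unit_normal \<Omega> x \<nu> \<longrightarrow> inner_value \<Omega> (grad w0) x \<bullet> \<nu> < k0"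
    and "regular_family \<Omega> \<F>"
  shows "(\<forall>r\<in>{1<..<2}. \<forall>\<T>\<in>\<F>. \<forall>N t. time_partition T N t \<longrightarrow>
            (\<forall>n\<in>{1..N}. \<forall>W Q. Q_solution \<Omega> \<T> k0 \<epsilon> w0 f t r (n - 1) W Q \<longrightarrow>
               (\<exists>Wn Qn. Q_step \<Omega> \<T> k0 \<epsilon> w0 f t r n (W (n - 1)) Wn Qn))) \<and>
         (\<exists>C>0. \<forall>r\<in>{1<..<2}. \<forall>\<T>\<in>\<F>. \<forall>N t.
            time_partition T N t \<and> (MAX n\<in>{1..N}. tstep t n) \<le> 1 / 2 \<longrightarrow>
            (\<forall>W Q. Q_solution \<Omega> \<T> k0 \<epsilon> w0 f t r N W Q \<longrightarrow>
               (MAX n\<in>{0..N}. Lp_norm 2 \<Omega> (W n))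
                 + (\<Sum>n=1..N. (Lp_norm 2 \<Omega> (\<lambda>x. W n x - W (n - 1) x))\<^sup>2)
                 + (\<Sum>n=1..N. tstep t n * Lp_norm r \<Omega> (Q n) powr r) \<le> C \<and>
               (\<Sum>n=1..N. (tstep t n)\<^sup>2 * (Lp_norm 2 \<Omega> (divergence (Q n)))\<^sup>2) \<le> C))"
proof
  have mesh: "mesh \<Omega> \<T>" if "\<T> \<in> \<F>" for \<T>
    using that assms(2,10) by (auto simp: mesh_def regular_family_def)
  show "\<forall>r\<in>{1<..<2}. \<forall>\<T>\<in>\<F>. \<forall>N t. time_partition T N t \<longrightarrow>
            (\<forall>n\<in>{1..N}. \<forall>W Q. Q_solution \<Omega> \<T> k0 \<epsilon> w0 f t r (n - 1) W Q \<longrightarrow>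
               (\<exists>Wn Qn. Q_step \<Omega> \<T> k0 \<epsilon> w0 f t r n (W (n - 1)) Wn Qn))"
  proof (intro ballI allI impI)
    fix r :: real and \<T> N t n W Q
    assume r: "r \<in> {1<..<2}" and \<T>: "\<T> \<in> \<F>" and t: "time_partition T N t" and n: "n \<in> {1..N}"
      and sol: "Q_solution \<Omega> \<T> k0 \<epsilon> w0 f t r (n - 1) W Q"
    interpret mesh \<Omega> \<T> by (rule mesh[OF \<T>])
    show "\<exists>Wn Qn. Q_step \<Omega> \<T> k0 \<epsilon> w0 f t r n (W (n - 1)) Wn Qn"
      using r by (intro Q_step_exists assms(4,5) time_partition_step(4)[OF t n] Q_solution_S[OF sol order_refl]
          time_mean_integrable[OF lmeasurable_domain assms(6) t n]) auto
  qed
  \<comment> \<open>The maximum of the initial datum is the only information about it that the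
    constant contains.\<close>
  have "compact (closure \<Omega>)" "continuous_on (closure \<Omega>) w0"
    using assms(2,8) by (auto simp: convex_polygonal_domain_def W1inf0_def)
  then have "bounded (w0 ` closure \<Omega>)"
    by (intro compact_imp_bounded compact_continuous_image)
  then obtain B where B: "\<And>x. x \<in> closure \<Omega> \<Longrightarrow> \<bar>w0 x\<bar> \<le> B"
    unfolding bounded_iff by auto
  define Fb where "Fb = (\<integral>(s, x). (f s x)\<^sup>2 \<partial>(lebesgue_on {0<..<T} \<Otimes>\<^sub>M lebesgue_on \<Omega>))"
  define E where "E = exp (2 * T) * (measure lebesgue \<Omega> * B\<^sup>2 + Fb)"
  define S where "S = measure lebesgue \<Omega> * B\<^sup>2 + Fb + T * E"
  define c where "c = 2 * k0 / (real DIM('a) + 1)"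
  have c: "c > 0" using assms(4) by (simp add: c_def)
  have Fb0: "Fb \<ge> 0"
    unfolding Fb_def by (intro Bochner_Integration.integral_nonneg) (auto simp: case_prod_unfold)
  have E0: "E \<ge> 0" unfolding E_def using Fb0 by simp
  have S0: "S \<ge> 0" unfolding S_def using Fb0 E0 assms(3) by simp
  \<comment> \<open>One constant for both claims: \<open>1 + E\<close>, \<open>S\<close> and
    \<open>S / c\<close> bound the three terms of the first sum, \<open>2 * S + Fb\<close> the
    divergence. The summand 1 also makes it positive.\<close>
  define C where "C = 1 + E + 2 * S + S / c + Fb"
  show "\<exists>C>0. \<forall>r\<in>{1<..<2}. \<forall>\<T>\<in>\<F>. \<forall>N t.
            time_partition T N t \<and> (MAX n\<in>{1..N}. tstep t n) \<le> 1 / 2 \<longrightarrow>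
            (\<forall>W Q. Q_solution \<Omega> \<T> k0 \<epsilon> w0 f t r N W Q \<longrightarrow>
               (MAX n\<in>{0..N}. Lp_norm 2 \<Omega> (W n))
                 + (\<Sum>n=1..N. (Lp_norm 2 \<Omega> (\<lambda>x. W n x - W (n - 1) x))\<^sup>2)
                 + (\<Sum>n=1..N. tstep t n * Lp_norm r \<Omega> (Q n) powr r) \<le> C \<and>
               (\<Sum>n=1..N. (tstep t n)\<^sup>2 * (Lp_norm 2 \<Omega> (divergence (Q n)))\<^sup>2) \<le> C)"
  proof (intro exI[of _ C] conjI ballI allI impI)
    show "C > 0" unfolding C_def using E0 S0 Fb0 c by (simp add: add_pos_nonneg)
    fix r :: real and \<T> N t W Q
    assume r: "r \<in> {1<..<2}" and \<T>: "\<T> \<in> \<F>"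
      and t: "time_partition T N t \<and> (MAX n\<in>{1..N}. tstep t n) \<le> 1 / 2"
      and sol: "Q_solution \<Omega> \<T> k0 \<epsilon> w0 f t r N W Q"
    interpret mesh \<Omega> \<T> by (rule mesh[OF \<T>])
    have \<tau>: "tstep t n \<le> 1 / 2" if "n \<in> {1..N}" for n
      using t that by (meson Max_ge finite_atLeastAtMost finite_imageI imageI order_trans)
    have r1: "1 < r" using r by simp
    note est = energy_estimate[OF sol assms(4,5) r1 assms(6) conjunct1[OF t] \<tau> B,
        folded Fb_def, folded E_def, folded S_def, folded c_def]
    let ?d = "\<Sum>n=1..N. (Lp_norm 2 \<Omega> (\<lambda>x. W n x - W (n - 1) x))\<^sup>2"
    let ?q = "\<Sum>n=1..N. tstep t n * Lp_norm r \<Omega> (Q n) powr r"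
    have "(MAX n\<in>{0..N}. Lp_norm 2 \<Omega> (W n)) \<le> 1 + E"
      using est(1) by (intro Max.boundedI) auto
    moreover have d0: "?d \<ge> 0" by (intro sum_nonneg) simp
    moreover have q0: "?q \<ge> 0"
      using time_partition_step(4)[OF conjunct1[OF t]] by (intro sum_nonneg) (simp add: less_imp_le)
    moreover have "?d \<le> S" using est(2) mult_nonneg_nonneg[OF less_imp_le[OF c] q0] by linarith
    moreover have "?q \<le> S / c"
      using est(2) d0 c by (simp add: field_simps)
    ultimately show "(MAX n\<in>{0..N}. Lp_norm 2 \<Omega> (W n)) + ?d + ?q \<le> C"
      unfolding C_def using S0 Fb0 by linarith
    have "S / c \<ge> 0" using S0 c by simp
    then show "(\<Sum>n=1..N. (tstep t n)\<^sup>2 * (Lp_norm 2 \<Omega> (divergence (Q n)))\<^sup>2) \<le> C"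
      using est(3) E0 unfolding C_def by linarith
  qed
qed

end
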